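(* Let $\delta\ge 7$ be an integer, let $\mathbf{u}$ be the standard sequence over $\{\mathtt a,\mathtt b\}$ whose slope has continued fraction expansion $\theta=[0,1,\lfloor \delta/2\rfloor,1,1,1,\ldots]$ (all partial quotients from the fourth on equal to $1$), let $\mathbf{y}=(1\,2\cdots\delta)^\omega$ and $\mathbf{y}'=(1'\,2'\cdots\delta')^\omega$. Then the sequence $\mathbf{x}_{2\delta}=\mathrm{colour}(\mathbf{u},\mathbf{y},\mathbf{y}')$ is a balanced sequence over an alphabet of $2\delta$ letters and its critical exponent equals $\frac{2\delta-1}{2\delta-2}$.
   Context: A Sturmian sequence is an aperiodic binary sequence having exactly $n+1$ distinct factors of each length $n$. A standard sequence is a Sturmian sequence $\mathbf{u}$ over $\{\mathtt a,\mathtt b\}$ such that both $\mathtt a\mathbf{u}$ and $\mathtt b\mathbf{u}$ are Sturmian. Convention: the letters are named so that the frequency of $\mathtt b$ exceeds that of $\mathtt a$, and the slope of $\mathbf{u}$ is $\theta=\rho_{\mathtt a}(\mathbf{u})/\rho_{\mathtt b}(\mathbf{u})$ (ratio of letter frequencies); a standard sequence is uniquely determined by its slope. For a binary sequence $\mathbf{u}$ over $\{\mathtt a,\mathtt b\}$ and sequences $\mathbf{y},\mathbf{y}'$ over disjoint alphabets, $\mathrm{colour}(\mathbf{u},\mathbf{y},\mathbf{y}')$ is the sequence obtained from $\mathbf{u}$ by replacing the subsequence of all occurrences of $\mathtt a$ by $\mathbf{y}$ (i.e. the $i$-th $\mathtt a$ becomes the $i$-th letter of $\mathbf{y}$) and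 the subsequence of all occurrences of $\mathtt b$ by $\mathbf{y}'$. A sequence is balanced if for any two factors $u,v$ of equal length and any letter $a$, $|u|_a-|v|_a\le 1$. The exponent of a nonempty word $z$ is $|z|/p$ where $p$ is the least period of $z$; the critical exponent of a sequence is the supremum of exponents of its nonempty factors. *)

theory Defs
  imports Complex_Main "HOL-Library.Extended_Real" "HOL-Library.Omega_Words_Fun"
begin

definition factors :: "'a word \<Rightarrow> 'a list set" where
  "factors x = {x [i \<rightarrow> j] | i j. i \<le> j}"

definition eventually_periodic :: "'a word \<Rightarrow> bool" where
  "eventually_periodic x \<longleftrightarrow> (\<exists>v w. w \<noteq> [] \<and> x = v \<frown> w\<^sup>\<omega>)"

datatype letter = Letter_a | Letter_b

definition sturmian :: "letter word \<Rightarrow> bool" where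
  "sturmian u \<longleftrightarrow> \<not> eventually_periodic u \<and>
     (\<forall>n. card {w \<in> factors u. length w = n} = n + 1)"

definition standard :: "letter word \<Rightarrow> bool" where
  "standard u \<longleftrightarrow> sturmian u \<and> sturmian (Letter_a ## u) \<and> sturmian (Letter_b ## u)"

definition has_frequency :: "'a word \<Rightarrow> 'a \<Rightarrow> real \<Rightarrow> bool" where
  "has_frequency x a \<rho> \<longleftrightarrow> (\<lambda>n. real (count_list (prefix n x) a) / real n) \<longlonglongrightarrow> \<rho>"

text \<open>The inequality between the frequencies is the naming convention for the two letters.\<close>

definition has_slope :: "letter word \<Rightarrow> real \<Rightarrow> bool" where
  "has_slope u \<theta> \<longleftrightarrow> (\<exists>\<rho>\<^sub>a \<rho>\<^sub>b. has_frequency u Letter_a \<rho>\<^sub>a \<and> has_frequency u Letter_b \<rho>\<^sub>b \<and>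
     \<rho>\<^sub>a < \<rho>\<^sub>b \<and> \<theta> = \<rho>\<^sub>a / \<rho>\<^sub>b)"

primrec convergent_cf :: "nat \<Rightarrow> nat word \<Rightarrow> real" where
  "convergent_cf 0 c = real (c 0)"
| "convergent_cf (Suc n) c = real (c 0) + 1 / convergent_cf n (suffix 1 c)"

text \<open>Infinite regular continued fractions of nonnegative numbers only, so that the partial
  quotients are natural numbers.\<close>

definition has_continued_fraction :: "real \<Rightarrow> nat word \<Rightarrow> bool" where
  "has_continued_fraction \<theta> c \<longleftrightarrow> (\<forall>i>0. c i > 0) \<and> (\<lambda>n. convergent_cf n c) \<longlonglongrightarrow> \<theta>"

text \<open>The disjointness of the two alphabets is realised by the sum type. Positions are counted
  from 0, so an occurrence of a letter preceded by \<open>i\<close> occurrences of the same letter receives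
  the colour with index \<open>i\<close>.\<close>

definition colour :: "letter word \<Rightarrow> 'c word \<Rightarrow> 'd word \<Rightarrow> ('c + 'd) word" where
  "colour u y y' = (\<lambda>n. case u n of
     Letter_a \<Rightarrow> Inl (y (count_list (prefix n u) Letter_a))
   | Letter_b \<Rightarrow> Inr (y' (count_list (prefix n u) Letter_b)))"

definition balanced :: "'a word \<Rightarrow> bool" where
  "balanced x \<longleftrightarrow> (\<forall>v\<in>factors x. \<forall>w\<in>factors x. \<forall>a. length v = length w \<longrightarrow>
     int (count_list v a) - int (count_list w a) \<le> 1)"

definition is_period :: "nat \<Rightarrow> 'a list \<Rightarrow> bool" where
  "is_period p z \<longleftrightarrow> p > 0 \<and> (\<forall>i. i + p < length z \<longrightarrow> z ! i = z ! (i + p))"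

definition exponent :: "'a list \<Rightarrow> real" where
  "exponent z = real (length z) / real (LEAST p. is_period p z)"

definition critical_exponent :: "'a word \<Rightarrow> ereal" where
  "critical_exponent x = (SUP z \<in> factors x - {[]}. ereal (exponent z))"

end

theory Submission
  imports Defs "HOL-Number_Theory.Fib"
begin

text \<open>
  The factor complexity forces \<open>u\<close> to be balanced: a shortest unbalanced pair of factors has the form
  \<open>aWa\<close>, \<open>bWb\<close> with a palindrome \<open>W\<close>. Exactly one of \<open>aW\<close>, \<open>bW\<close> is right special, and it is
  avoided for so long after an occurrence of the other pattern that \<open>u\<close> becomes eventually periodic.

  By balancedness the discrepancy of the letter counts of \<open>u\<close> takes values in an interval of length
  \<open>1\<close> and moves like a rotation by the frequency of \<open>a\<close>. A repetition in \<open>x\<close> of a word that contains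
  both letters returns after \<open>\<delta> N\<close> positions with \<open>\<delta> r\<close> letters \<open>a\<close>, so the rotation by \<open>\<delta> N\<close> has error
  \<open>\<delta>\<close> times that of \<open>N\<close>; this error is bounded by the longest gap left by the orbit over the repeated
  word. If the word is too long for the claimed exponent, then \<open>N < 2 l\<close> for its length \<open>l\<close>, and
  the best approximation property of the convergents makes the error exceed the gap, because
  \<open>\<delta> \<ge> 7\<close> is greater than the fourth power of the golden ratio. Repetitions of \<open>a\<close>, \<open>b\<close> and \<open>bb\<close>
  are handled by counting; two equal colours of \<open>b\<close> at distance \<open>2 \<delta> - 2\<close> attain the bound.
\<close>

section \<open>Sturmian words are balanced\<close>

declare subseq_to_Suc [simp del]

section \<open>Letter counts in windows of a word\<close>

definition occ :: "'a word \<Rightarrow> 'a \<Rightarrow> nat \<Rightarrow> nat \<Rightarrow> nat" where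
  "occ w c i n = count_list (w [i \<rightarrow> i + n]) c"

lemma occ_0 [simp]: "occ w c i 0 = 0"
  by (simp add: occ_def)

lemma occ_add: "occ w c i (m + n) = occ w c i m + occ w c (i + m) n"
proof -
  have "[i..<i + (m + n)] = [i..<i + m] @ [i + m..<i + m + n]"
    using upt_add_eq_append[of i "i + m" n] by (simp add: add.assoc)
  then show ?thesis
    by (simp add: occ_def subsequence_def)
qed

lemma occ_1: "occ w c i (Suc 0) = of_bool (w i = c)"
  by (simp add: occ_def subsequence_def)

lemma occ_Suc: "occ w c i (Suc n) = occ w c i n + of_bool (w (i + n) = c)"
  using occ_add[of w c i n 1] by (simp add: occ_1)

lemma occ_Suc_left: "occ w c i (Suc n) = of_bool (w i = c) + occ w c (Suc i) n"
  using occ_add[of w c i 1 n] by (simp add: occ_1)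

lemma occ_le: "occ w c i n \<le> n"
  by (induction n) (auto simp: occ_Suc)

lemma occ_mono: "m \<le> n \<Longrightarrow> occ w c i m \<le> occ w c i n"
  using occ_add[of w c i m "n - m"] by simp

lemma occ_ab: "occ u Letter_a i n + occ u Letter_b i n = n"
proof (induction n)
  case (Suc n)
  then show ?case by (cases "u (i + n)") (auto simp: occ_Suc)
qed simp

lemma count_prefix_eq_occ: "count_list (prefix n w) c = occ w c 0 n"
  by (simp add: occ_def)

lemma subsequence_in_factors: "w [i \<rightarrow> i + n] \<in> factors w"
  using le_add1 by (fastforce simp: factors_def)

lemma factors_length_eq: "{v \<in> factors w. length v = n} = range (\<lambda>i. w [i \<rightarrow> i + n])"
proof (intro set_eqI iffI)
  fix v assume "v \<in> {v \<in> factors w. length v = n}"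
  then obtain i j where "v = w [i \<rightarrow> j]" "i \<le> j" "length v = n"
    by (auto simp: factors_def)
  then have "v = w [i \<rightarrow> i + n]" by auto
  then show "v \<in> range (\<lambda>i. w [i \<rightarrow> i + n])" by (rule range_eqI)
qed (use subsequence_in_factors in auto)

lemma balanced_iff_occ: "balanced w \<longleftrightarrow> (\<forall>c i j n. occ w c i n \<le> occ w c j n + 1)"
proof
  assume bal: "balanced w"
  show "\<forall>c i j n. occ w c i n \<le> occ w c j n + 1"
  proof (intro allI)
    fix c i j n
    have "int (occ w c i n) - int (occ w c j n) \<le> 1"
      using bal[unfolded balanced_def, rule_format, of "w [i \<rightarrow> i + n]" "w [j \<rightarrow> j + n]" c]
      by (simp add: subsequence_in_factors occ_def)
    then show "occ w c i n \<le> occ w c j n + 1" by linarith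
  qed
next
  assume *: "\<forall>c i j n. occ w c i n \<le> occ w c j n + 1"
  show "balanced w"
    unfolding balanced_def
  proof (intro ballI allI impI)
    fix v v' c assume "v \<in> factors w" "v' \<in> factors w" "length v = length v'"
    then have "v \<in> range (\<lambda>i. w [i \<rightarrow> i + length v])" "v' \<in> range (\<lambda>i. w [i \<rightarrow> i + length v])"
      unfolding factors_length_eq[of w "length v", symmetric] by simp_all
    then obtain i j where "v = w [i \<rightarrow> i + length v]" "v' = w [j \<rightarrow> j + length v]"
      by (elim rangeE) (rule that)
    then have "count_list v c = occ w c i (length v)" "count_list v' c = occ w c j (length v)"
      unfolding occ_def by metis+
    then show "int (count_list v c) - int (count_list v' c) \<le> 1"
      using *[rule_format, of c i "length v" j] by linarith
  qed
qed

section \<open>Shortest unbalanced pairs of windows\<close>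

lemma of_bool_letter_cong: "of_bool (c = Letter_a) = (of_bool (d = Letter_a) :: nat) \<Longrightarrow> c = d"
  by (cases c; cases d) simp_all

text \<open>Take two windows of least length \<open>m + 2\<close> whose counts of \<open>a\<close>
  differ by at least 2. Shorter windows are balanced: comparing prefixes gives equal inner words,
  and comparing prefixes with suffixes makes the inner word a palindrome.\<close>

lemma minimal_unbalanced_pair:
  assumes "\<not> (\<forall>i j n. occ u Letter_a i n \<le> occ u Letter_a j n + 1)"
  obtains i j m where "u i = Letter_a" "u (i + m + 1) = Letter_a"
    "u j = Letter_b" "u (j + m + 1) = Letter_b"
    "\<And>s. s < m \<Longrightarrow> u (i + 1 + s) = u (j + 1 + s)"
    "\<And>s. s < m \<Longrightarrow> u (i + 1 + s) = u (i + m - s)"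
proof -
  let ?f = "occ u Letter_a"
  define unb where "unb n \<longleftrightarrow> (\<exists>i j. ?f i n > ?f j n + 1)" for n
  define n where "n = (LEAST n. unb n)"
  have "\<exists>n. unb n" using assms by (auto simp: unb_def not_le)
  then have "unb n" unfolding n_def by (rule LeastI_ex)
  then obtain i j where ij: "?f i n > ?f j n + 1" by (auto simp: unb_def)
  have min: "?f i' l \<le> ?f j' l + 1" if "l < n" for i' j' l
    using not_less_Least[of l unb] that by (auto simp: n_def unb_def not_less)
  have "n \<ge> 2" using ij occ_le[of u Letter_a i n] by linarith
  then obtain m where n: "n = m + 2" by (metis add.commute le_Suc_ex)
  \<comment> \<open>The rest after a proper prefix contributes at most 1 to a difference of at least
    2, so the prefix contributes exactly 1.\<close>
  have h1: "?f i (Suc s) = ?f j (Suc s) + 1" if "s \<le> m" for s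
  proof -
    have "n = Suc s + (m + 1 - s)" using n that by simp
    then have "?f i n = ?f i (Suc s) + ?f (i + Suc s) (m + 1 - s)"
      "?f j n = ?f j (Suc s) + ?f (j + Suc s) (m + 1 - s)"
      using occ_add by metis+
    moreover have "?f (i + Suc s) (m + 1 - s) \<le> ?f (j + Suc s) (m + 1 - s) + 1"
      by (rule min) (use n in simp)
    moreover have "?f i (Suc s) \<le> ?f j (Suc s) + 1"
      by (rule min) (use n that in simp)
    ultimately show ?thesis using ij by linarith
  qed
  have first: "u i = Letter_a \<and> u j \<noteq> Letter_a"
    using h1[of 0] by (cases "u i"; cases "u j") (simp_all add: occ_1)
  have "?f i (Suc (Suc m)) > ?f j (Suc (Suc m)) + 1" using ij n by simp
  then have last: "u (i + m + 1) = Letter_a \<and> u (j + m + 1) \<noteq> Letter_a"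
    using h1[of m] by (cases "u (i + m + 1)"; cases "u (j + m + 1)") (simp_all add: occ_Suc[of _ _ _ "Suc m"])
  have mid: "u (i + 1 + s) = u (j + 1 + s)" if "s < m" for s
  proof -
    have "?f i (Suc (Suc s)) = ?f j (Suc (Suc s)) + 1" "?f i (Suc s) = ?f j (Suc s) + 1"
      using h1[of s] h1[of "Suc s"] that by simp_all
    then have "u (i + Suc s) = u (j + Suc s)"
      unfolding occ_Suc[of _ _ _ "Suc s"] by (intro of_bool_letter_cong) linarith
    then show ?thesis by simp
  qed
  have suf_eq: "?f (i + m + 1 - s) s = ?f (j + m + 1 - s) s" if "s \<le> m" for s
  proof -
    have "?f i (Suc m) = ?f i (Suc (m - s)) + ?f (i + m + 1 - s) s"
      "?f j (Suc m) = ?f j (Suc (m - s)) + ?f (j + m + 1 - s) s"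
      using occ_add[of u Letter_a _ "Suc (m - s)" s] that by (simp_all add: Suc_diff_le)
    with h1[of m] h1[of "m - s"] show ?thesis by simp
  qed
  \<comment> \<open>A prefix starting with \<open>a\<close> is compared with a suffix of the other
    window ending in \<open>b\<close>, and a suffix ending in \<open>a\<close> with a prefix
    starting with \<open>b\<close>.\<close>
  have pal: "?f (i + 1) s = ?f (i + m + 1 - s) s" if "s \<le> m" for s
  proof -
    have "?f i (Suc s) \<le> ?f (j + m + 1 - s) (Suc s) + 1"
      "?f (i + m + 1 - s) (Suc s) \<le> ?f j (Suc s) + 1"
      using n that by (intro min; simp)+
    moreover have "?f i (Suc s) = 1 + ?f (i + 1) s"
      using first by (simp add: occ_Suc_left)
    moreover have "?f (j + m + 1 - s) (Suc s) = ?f (j + m + 1 - s) s"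
      "?f (i + m + 1 - s) (Suc s) = ?f (i + m + 1 - s) s + 1"
      using last that by (simp_all add: occ_Suc)
    ultimately show ?thesis using h1[of s] suf_eq[of s] that by linarith
  qed
  have pal': "u (i + 1 + s) = u (i + m - s)" if "s < m" for s
  proof -
    have "?f (i + m + 1 - Suc s) (Suc s) = of_bool (u (i + m - s) = Letter_a) + ?f (i + m + 1 - s) s"
      using that by (simp add: occ_Suc_left Suc_diff_le)
    then show ?thesis
      using pal[of s] pal[of "Suc s"] that by (intro of_bool_letter_cong) (simp add: occ_Suc)
  qed
  have "u j = Letter_b" "u (j + m + 1) = Letter_b"
    using first last letter.exhaust by blast+
  then show thesis using that first last mid pal' by blast
qed

section \<open>Right special factors of Sturmian words\<close>

definition right_special :: "letter word \<Rightarrow> letter list \<Rightarrow> bool" where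
  "right_special u v \<longleftrightarrow> (\<forall>c. v @ [c] \<in> factors u)"

lemma subseq_Suc: "w [i \<rightarrow> i + Suc n] = w [i \<rightarrow> i + n] @ [w (i + n)]"
  by (simp only: add_Suc_right subseq_to_Suc le_add1)

lemma subseq_Suc_left: "w [i \<rightarrow> i + Suc n] = w i # w [Suc i \<rightarrow> Suc i + n]"
  by (simp add: subsequence_def upt_conv_Cons del: upt_Suc)

lemma butlast_factors:
  "butlast ` {v \<in> factors u. length v = Suc n} = {v \<in> factors u. length v = n}"
  unfolding factors_length_eq by (simp only: image_image subseq_Suc butlast_snoc)

text \<open>If two distinct right special words lose their extensions by \<open>b\<close>, dropping
  the last letter still maps the remaining \<open>n\<close> words onto all \<open>n + 1\<close>
  factors of length \<open>n\<close>.\<close>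

lemma right_special_unique:
  assumes "sturmian u" "right_special u v" "right_special u v'" "length v = length v'"
  shows "v = v'"
proof (rule ccontr)
  assume "v \<noteq> v'"
  define n where "n = length v"
  let ?L = "\<lambda>n. {v \<in> factors u. length v = n}"
  let ?S = "?L (Suc n) - {v @ [Letter_b], v' @ [Letter_b]}"
  have card: "card (?L n) = n + 1" "card (?L (Suc n)) = n + 2"
    using assms(1) by (simp_all add: sturmian_def)
  then have fin: "finite (?L (Suc n))" by (intro card_ge_0_finite) simp
  have sub: "{v @ [Letter_b], v' @ [Letter_b]} \<subseteq> ?L (Suc n)"
    using assms by (auto simp: right_special_def n_def)
  have "card ?S = n"
    using card_Diff_subset[OF _ sub] card \<open>v \<noteq> v'\<close> by simp
  moreover have "?L n \<subseteq> butlast ` ?S"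
  proof
    fix z assume z: "z \<in> ?L n"
    show "z \<in> butlast ` ?S"
    proof (cases "z \<in> {v, v'}")
      case True
      then have "z @ [Letter_a] \<in> ?S"
        using assms by (auto simp: right_special_def n_def)
      then show ?thesis by force
    next
      case False
      from z obtain y where "y \<in> ?L (Suc n)" "z = butlast y"
        using butlast_factors[of u n] by blast
      then show ?thesis using False by force
    qed
  qed
  then have "card (?L n) \<le> card ?S"
    using surj_card_le fin by blast
  ultimately show False using card by simp
qed

text \<open>Dropping the last letter maps \<open>n + 2\<close> words onto \<open>n + 1\<close>, so
  two of them differ only in the last letter.\<close>

lemma right_special_exists:
  assumes "sturmian u"
  obtains v where "right_special u v" "length v = n"
proof -
  let ?L = "\<lambda>n. {v \<in> factors u. length v = n}"
  have card: "card (?L n) = n + 1" "card (?L (Suc n)) = n + 2"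
    using assms by (simp_all add: sturmian_def)
  have "\<not> inj_on butlast (?L (Suc n))"
    using card_image[of butlast "?L (Suc n)"] card butlast_factors[of u n] by auto
  then obtain y z where yz: "y \<in> ?L (Suc n)" "z \<in> ?L (Suc n)" "butlast y = butlast z" "y \<noteq> z"
    by (auto simp: inj_on_def)
  define v where "v = butlast y"
  have "y \<noteq> []" "z \<noteq> []" using yz by auto
  then have y: "y = v @ [last y]" and z: "z = v @ [last z]"
    using yz(3) append_butlast_last_id unfolding v_def by metis+
  have "last y \<noteq> last z" using y z yz(4) by metis
  then have "c = last y \<or> c = last z" for c
    by (cases c; cases "last y"; cases "last z") auto
  then have "v @ [c] \<in> factors u" for c
    using y z yz(1,2) by (metis (no_types, lifting) mem_Collect_eq)
  then have "right_special u v" by (simp add: right_special_def)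
  moreover have "length v = n" using yz(1) by (simp add: v_def)
  ultimately show thesis by (rule that)
qed

section \<open>Balancedness from factor complexity\<close>

lemma eventually_periodicI:
  assumes "p > 0" "\<And>n. n \<ge> i \<Longrightarrow> w (n + p) = w n"
  shows "eventually_periodic w"
proof -
  have per: "w (i + (n + q * p)) = w (i + n)" for n q
  proof (induction q)
    case (Suc q)
    have "w (i + (n + Suc q * p)) = w ((i + (n + q * p)) + p)" by (simp add: algebra_simps)
    with Suc assms(2)[of "i + (n + q * p)"] show ?case by simp
  qed simp
  have eq: "w (i + n) = w (i + n mod p)" for n
    using per[of "n mod p" "n div p"] by simp
  have "w = (w [0 \<rightarrow> i]) \<frown> (w [i \<rightarrow> i + p])\<^sup>\<omega>"
  proof
    fix n
    show "w n = ((w [0 \<rightarrow> i]) \<frown> (w [i \<rightarrow> i + p])\<^sup>\<omega>) n"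
      using eq[of "n - i"] assms(1) by (cases "n < i") (simp_all add: conc_def iter_def)
  qed
  moreover have "w [i \<rightarrow> i + p] \<noteq> []" using assms(1) by (simp add: subsequence_def)
  ultimately show ?thesis unfolding eventually_periodic_def by blast
qed

text \<open>An unbalanced pair yields \<open>aWa\<close> and \<open>bWb\<close>. The right special
  word of length \<open>m + 1\<close> is \<open>cW\<close> for one letter \<open>c\<close>. From an
  occurrence of \<open>dWd\<close> with the other letter \<open>d\<close> on, \<open>cW\<close> is
  never met, so each window determines the next and the word becomes periodic.\<close>

lemma sturmian_imp_occ_balanced:
  assumes st: "sturmian u"
  shows "occ u Letter_a i n \<le> occ u Letter_a j n + 1"
proof (rule ccontr)
  assume "\<not> ?thesis"
  then have "\<not> (\<forall>i j n. occ u Letter_a i n \<le> occ u Letter_a j n + 1)" by blast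
  then obtain i j m where u: "u i = Letter_a" "u (i + m + 1) = Letter_a"
    "u j = Letter_b" "u (j + m + 1) = Letter_b"
    and mid: "\<And>s. s < m \<Longrightarrow> u (i + 1 + s) = u (j + 1 + s)"
    and pal: "\<And>s. s < m \<Longrightarrow> u (i + 1 + s) = u (i + m - s)"
    using minimal_unbalanced_pair[of u] by metis
  define W where "W = u [Suc i \<rightarrow> Suc i + m]"
  have W': "W = u [Suc j \<rightarrow> Suc j + m]"
    using mid by (intro nth_equalityI) (simp_all add: W_def)
  have lenW: "length W = m" by (simp add: W_def)
  have Wnth: "W ! s = u (i + 1 + s)" if "s < m" for s
    using that by (simp add: W_def)
  have Wpal: "W ! s = W ! (m - 1 - s)" if "s < m" for s
    using that pal[of s] by (simp add: Wnth Suc_diff_Suc)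
  have specW: "right_special u W"
    unfolding right_special_def
  proof
    fix c
    have "W @ [u (i + m + 1)] \<in> factors u" "W @ [u (j + m + 1)] \<in> factors u"
      using subsequence_in_factors[of u "Suc i" "Suc m"] subsequence_in_factors[of u "Suc j" "Suc m"]
      unfolding subseq_Suc W_def[symmetric] W'[symmetric] by simp_all
    then show "W @ [c] \<in> factors u" using u by (cases c) auto
  qed
  obtain v where v: "right_special u v" "length v = Suc m"
    using right_special_exists[OF st] by blast
  then obtain c v' where cv: "v = c # v'" "length v' = m" by (cases v) auto
  \<comment> \<open>A suffix of a right special word is right special; uniqueness then identifies it
    with \<open>W\<close>.\<close>
  have "right_special u v'"
    unfolding right_special_def
  proof
    fix d
    have "c # v' @ [d] \<in> factors u" using v(1) cv by (simp add: right_special_def)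
    then have "c # v' @ [d] \<in> {w \<in> factors u. length w = Suc (Suc m)}" using cv by simp
    then obtain k where "c # v' @ [d] = u [k \<rightarrow> k + Suc (Suc m)]"
      unfolding factors_length_eq by blast
    then have "v' @ [d] = u [Suc k \<rightarrow> Suc k + Suc m]"
      unfolding subseq_Suc_left[of u k "Suc m"] by simp
    then show "v' @ [d] \<in> factors u" by (metis subsequence_in_factors)
  qed
  then have "v' = W" using right_special_unique[OF st] specW cv lenW by simp
  then have v_eq: "v = c # W" using cv by simp
  define d where "d = (if c = Letter_a then Letter_b else Letter_a)"
  have "d \<noteq> c" by (cases c) (auto simp: d_def)
  obtain e where e: "u e = d" "u (e + m + 1) = d" "W = u [Suc e \<rightarrow> Suc e + m]"
    using u W_def W' by (cases "c = Letter_a") (auto simp: d_def split: if_splits)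
  have enth: "u (e + 1 + s) = W ! s" if "s < m" for s
    using that e(3) by simp
  let ?f = "\<lambda>t. (u [t \<rightarrow> t + Suc m])"
  text \<open>Were \<open>cW\<close> to start inside the occurrence of \<open>dWd\<close>, comparing the letter \<open>d\<close> at the end
    with the mirror image of \<open>c\<close> in \<open>W\<close> would give \<open>c = d\<close>.\<close>
  have avoid: "?f (e + t) \<noteq> v" if "t \<le> m + 1" for t
  proof
    assume "?f (e + t) = v"
    then have *: "u (e + t) = c" "u [Suc (e + t) \<rightarrow> Suc (e + t) + m] = W"
      unfolding subseq_Suc_left v_eq by auto
    from *(1) e(1) \<open>d \<noteq> c\<close> have "t \<noteq> 0" by (metis add_0_right)
    moreover from *(1) e(2) \<open>d \<noteq> c\<close> have "t \<noteq> m + 1" by (metis add.assoc)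
    ultimately have t: "1 \<le> t" "t \<le> m" using that by auto
    have "W ! (m - t) = u (Suc (e + t) + (m - t))"
      using t *(2)[symmetric] by simp
    also have "\<dots> = d" using e(2) t by simp
    finally have "W ! (t - 1) = d" using Wpal[of "m - t"] t by simp
    moreover have "W ! (t - 1) = c" using enth[of "t - 1"] *(1) t by simp
    ultimately show False using \<open>d \<noteq> c\<close> by simp
  qed
  \<comment> \<open>Two different continuations would make the window right special, hence equal to
    \<open>v\<close>.\<close>
  have succ: "?f (Suc s) = ?f (Suc t)" if eq: "?f s = ?f t" and ne: "?f s \<noteq> v" for s t
  proof -
    have "u (s + Suc m) = u (t + Suc m)"
    proof (rule ccontr)
      assume "u (s + Suc m) \<noteq> u (t + Suc m)"
      then have "x = u (s + Suc m) \<or> x = u (t + Suc m)" for x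
        by (cases x; cases "u (s + Suc m)"; cases "u (t + Suc m)") auto
      moreover have "?f s @ [u (s + Suc m)] \<in> factors u" "?f t @ [u (t + Suc m)] \<in> factors u"
        unfolding subseq_Suc[of u _ "Suc m", symmetric] by (rule subsequence_in_factors)+
      ultimately have "right_special u (?f s)"
        unfolding right_special_def using eq by metis
      then have "?f s = v"
        using right_special_unique[OF st _ v(1)] v(2) by simp
      then show False using ne by simp
    qed
    moreover have "u [Suc s \<rightarrow> Suc s + m] = u [Suc t \<rightarrow> Suc t + m]"
      using eq unfolding subseq_Suc_left by simp
    ultimately show ?thesis unfolding subseq_Suc by simp
  qed
  let ?L = "{w \<in> factors u. length w = Suc m}"
  have card: "card ?L = m + 2" using st by (simp add: sturmian_def)
  have "v \<in> ?L"
  proof -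
    have "v @ [Letter_a] \<in> {w \<in> factors u. length w = Suc (Suc m)}"
      using v by (simp add: right_special_def)
    then have "butlast (v @ [Letter_a]) \<in> ?L"
      using butlast_factors[of u "Suc m"] by blast
    then show ?thesis by simp
  qed
  \<comment> \<open>Pigeonhole: \<open>m + 2\<close> windows avoid \<open>v\<close> and thus take at
    most \<open>m + 1\<close> values.\<close>
  have "(\<lambda>t. ?f (e + t)) ` {..m + 1} \<subseteq> ?L - {v}"
    using avoid subsequence_in_factors[of u _ "Suc m"] by auto
  moreover have "finite ?L" using card by (intro card_ge_0_finite) simp
  ultimately have "card ((\<lambda>t. ?f (e + t)) ` {..m + 1}) \<le> card (?L - {v})"
    by (intro card_mono) auto
  also have "\<dots> = m + 1" using card \<open>v \<in> ?L\<close> by (simp add: card_Diff_singleton)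
  finally have "\<not> inj_on (\<lambda>t. ?f (e + t)) {..m + 1}"
    using card_image by fastforce
  then obtain s t where st': "s < t" "t \<le> m + 1" "?f (e + s) = ?f (e + t)"
    unfolding inj_on_def by (metis atMost_iff linorder_neqE_nat)
  define p where "p = t - s"
  have p: "p > 0" "t = s + p" using st' by (auto simp: p_def)
  \<comment> \<open>The coincidence propagates by \<open>succ\<close> while \<open>v\<close> is
    avoided. The first \<open>p\<close> windows avoid \<open>v\<close> by \<open>avoid\<close>, and
    later ones repeat earlier ones.\<close>
  have per: "?f (e + s + r) = ?f (e + s + r + p) \<and> ?f (e + s + r) \<noteq> v" for r
  proof (induction r rule: less_induct)
    case (less r)
    have ne: "?f (e + s + r) \<noteq> v"
    proof (cases "r < p")
      case True
      then show ?thesis using avoid[of "s + r"] p st' by (simp add: add.assoc)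
    next
      case False
      then have "?f (e + s + (r - p)) = ?f (e + s + r)" "?f (e + s + (r - p)) \<noteq> v"
        using less[of "r - p"] p by (auto simp: add.assoc)
      then show ?thesis by simp
    qed
    moreover have "?f (e + s + r) = ?f (e + s + r + p)"
    proof (cases r)
      case 0
      then show ?thesis using st'(3) p by (simp add: add.assoc)
    next
      case (Suc r')
      then have "?f (e + s + r') = ?f (e + s + r' + p)" "?f (e + s + r') \<noteq> v"
        using less[of r'] by blast+
      from succ[OF this] Suc show ?thesis by simp
    qed
    ultimately show ?case by simp
  qed
  have "u (n + p) = u n" if "n \<ge> e + s" for n
    using per[of "n - (e + s)"] that unfolding subseq_Suc_left by simp
  then have "eventually_periodic u" using p(1) eventually_periodicI by blast
  then show False using st by (simp add: sturmian_def)
qed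

section \<open>Frequencies, continued fractions and rotations\<close>

text \<open>Split the prefix of length \<open>K * n\<close> into \<open>K\<close> blocks of length
  \<open>n\<close>. Each block count differs by at most 1 from that of the given window; divide by
  \<open>K * n\<close> and let \<open>K\<close> grow.\<close>

lemma occ_frequency_bound:
  assumes bal: "\<And>i j n. occ w c i n \<le> occ w c j n + 1" and freq: "has_frequency w c \<rho>"
  shows "\<bar>real (occ w c i n) - real n * \<rho>\<bar> \<le> 1"
proof (cases "n = 0")
  case False
  have upper: "occ w c 0 (K * n) \<le> K * (occ w c i n + 1)" for K
  proof (induction K)
    case (Suc K)
    have "occ w c 0 (Suc K * n) = occ w c 0 (K * n) + occ w c (K * n) n"
      using occ_add[of w c 0 "K * n" n] by (simp add: add.commute)
    also have "\<dots> \<le> K * (occ w c i n + 1) + (occ w c i n + 1)"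
      using Suc bal by (intro add_mono)
    finally show ?case by simp
  qed simp
  have lower: "K * occ w c i n \<le> occ w c 0 (K * n) + K" for K
  proof (induction K)
    case (Suc K)
    have "occ w c 0 (Suc K * n) = occ w c 0 (K * n) + occ w c (K * n) n"
      using occ_add[of w c 0 "K * n" n] by (simp add: add.commute)
    then show ?case using Suc bal[of i n "K * n"] by simp
  qed simp
  let ?f = "\<lambda>K. real (occ w c 0 (Suc K * n)) / real (Suc K * n)"
  have "strict_mono (\<lambda>K. Suc K * n)"
    using False by (intro strict_monoI mult_less_mono1) auto
  from LIMSEQ_subseq_LIMSEQ[OF freq[unfolded has_frequency_def] this]
  have lim: "?f \<longlonglongrightarrow> \<rho>"
    by (simp only: o_def count_prefix_eq_occ)
  have cancel: "real (Suc K) * x / real (Suc K * n) = x / n" for K x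
    unfolding of_nat_mult by (rule mult_divide_mult_cancel_left) simp
  have "?f K \<le> (real (occ w c i n) + 1) / n" for K
  proof -
    have "real (occ w c 0 (Suc K * n)) \<le> real (Suc K * (occ w c i n + 1))"
      using upper[of "Suc K"] of_nat_mono by blast
    then have "real (occ w c 0 (Suc K * n)) \<le> real (Suc K) * (real (occ w c i n) + 1)"
      by (simp only: of_nat_mult of_nat_add of_nat_1)
    from divide_right_mono[OF this, of "real (Suc K * n)"] show ?thesis
      unfolding cancel by simp
  qed
  then have "\<rho> \<le> (real (occ w c i n) + 1) / n"
    by (intro LIMSEQ_le_const2[OF lim]) auto
  moreover have "?f K \<ge> (real (occ w c i n) - 1) / n" for K
  proof -
    have "real (Suc K * occ w c i n) \<le> real (occ w c 0 (Suc K * n) + Suc K)"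
      using lower[of "Suc K"] of_nat_mono by blast
    then have "real (Suc K) * (real (occ w c i n) - 1) \<le> real (occ w c 0 (Suc K * n))"
      unfolding of_nat_mult of_nat_add right_diff_distrib mult_1_right by linarith
    from divide_right_mono[OF this, of "real (Suc K * n)"] show ?thesis
      unfolding cancel by simp
  qed
  then have "\<rho> \<ge> (real (occ w c i n) - 1) / n"
    by (intro LIMSEQ_le_const[OF lim]) auto
  ultimately show ?thesis using False by (simp add: field_simps abs_le_iff)
qed simp

section \<open>The inverse golden ratio and the value of the slope\<close>

definition \<psi> :: real where
  "\<psi> = (sqrt 5 - 1) / 2"

lemma psi_square: "\<psi> ^ 2 = 1 - \<psi>"
  by (simp add: \<psi>_def power2_eq_square field_simps)

text \<open>Both bounds are quotients of Fibonacci numbers; 13/21 is the exact threshold at which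
  \<open>7 * \<psi> ^ 4 = 14 - 21 * \<psi>\<close> would drop to 1.\<close>

lemma psi_bounds: "3 / 5 < \<psi>" "\<psi> < 13 / 21"
proof -
  have "11 / 5 < sqrt 5" by (rule real_less_rsqrt) (simp add: power2_eq_square)
  moreover have "sqrt 5 < 47 / 21" by (rule real_less_lsqrt) (simp_all add: power2_eq_square)
  ultimately show "3 / 5 < \<psi>" "\<psi> < 13 / 21" by (simp_all add: \<psi>_def)
qed

lemma psi_pos [simp]: "0 < \<psi>" and psi_nonneg [simp]: "0 \<le> \<psi>" and psi_less_1 [simp]: "\<psi> < 1"
  using psi_bounds by linarith+

lemma psi_power_Suc_Suc: "\<psi> ^ Suc (Suc n) = \<psi> ^ n - \<psi> ^ Suc n"
proof -
  have "\<psi> ^ Suc (Suc n) = \<psi> ^ n * \<psi> ^ 2" by (simp add: power2_eq_square)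
  then show ?thesis by (simp add: psi_square algebra_simps)
qed

lemma psi_inverse: "1 / (1 + \<psi>) = \<psi>"
proof -
  have "1 = \<psi> * (1 + \<psi>)" by (simp add: algebra_simps psi_square flip: power2_eq_square)
  moreover have "1 + \<psi> \<noteq> 0" using psi_pos by linarith
  ultimately show ?thesis by (metis nonzero_eq_divide_eq)
qed

text \<open>The map t -> 1 + 1/t fixes \<open>1 + \<psi>\<close> and, for t \<ge> 1, shrinks the
  distance to it at least by the factor \<psi>.\<close>

lemma convergent_cf_ones: "(\<lambda>n. convergent_cf n (\<lambda>_. 1)) \<longlonglongrightarrow> 1 + \<psi>"
proof -
  let ?X = "\<lambda>n. convergent_cf n (\<lambda>_. 1)"
  have step: "?X (Suc n) = 1 + 1 / ?X n" for n
    by (simp add: suffix_def)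
  have ge1: "?X n \<ge> 1" for n
  proof (induction n)
    case (Suc n)
    then show ?case unfolding step by simp
  qed simp
  have bound: "\<bar>?X n - (1 + \<psi>)\<bar> \<le> \<psi> ^ n" for n
  proof (induction n)
    case (Suc n)
    have pos: "?X n > 0" using ge1[of n] by linarith
    have frac: "1 / x - 1 / y = - (1 / y) * ((x - y) / x)" if "x > 0" "y > 0" for x y :: real
      using that by (simp add: field_simps)
    have "?X (Suc n) - (1 + \<psi>) = 1 / ?X n - 1 / (1 + \<psi>)"
      unfolding step psi_inverse by simp
    also have "\<dots> = - (1 / (1 + \<psi>)) * ((?X n - (1 + \<psi>)) / ?X n)"
      using pos psi_pos by (intro frac) linarith+
    finally have "\<bar>?X (Suc n) - (1 + \<psi>)\<bar> = \<psi> * (\<bar>?X n - (1 + \<psi>)\<bar> / ?X n)"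
      unfolding psi_inverse using pos by (simp add: abs_mult)
    also have "\<bar>?X n - (1 + \<psi>)\<bar> / ?X n \<le> \<bar>?X n - (1 + \<psi>)\<bar> / 1"
      using ge1[of n] by (intro divide_left_mono) auto
    also have "\<dots> \<le> \<psi> ^ n" using Suc by simp
    finally show ?case by (simp add: mult_left_mono)
  qed (simp add: less_imp_le)
  have "(\<lambda>n. \<psi> ^ n) \<longlonglongrightarrow> 0" by (intro LIMSEQ_power_zero) simp
  then have "(\<lambda>n. ?X n - (1 + \<psi>)) \<longlonglongrightarrow> 0"
    by (rule tendsto_0_le[where K = 1]) (use bound in simp)
  then show ?thesis by (simp add: LIM_zero_iff)
qed

lemma slope_value:
  assumes "has_continued_fraction \<theta> ([0, 1, k] \<frown> [1]\<^sup>\<omega>)" and "k > 0"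
  shows "\<theta> = (real k + \<psi>) / (1 + (real k + \<psi>))"
proof -
  have ones: "[1]\<^sup>\<omega> = (\<lambda>_. 1 :: nat)" by (rule ext) simp
  define c where "c = [0, 1, k] \<frown> (\<lambda>_. 1 :: nat)"
  have c: "c 0 = 0" "c (Suc 0) = 1" "c (Suc (Suc 0)) = k"
    "suffix (Suc (Suc (Suc 0))) c = (\<lambda>_. 1)"
    by (auto simp: c_def conc_def suffix_def)
  \<comment> \<open>Index \<open>n + 3\<close> peels off the three leading partial quotients and
    leaves the convergent of index \<open>n\<close> of the tail of ones.\<close>
  have "convergent_cf (n + 3) c = 1 / (1 + 1 / (real k + 1 / convergent_cf n (\<lambda>_. 1)))" for n
    by (simp add: eval_nat_numeral c)
  moreover have "(\<lambda>n. 1 / (1 + 1 / (real k + 1 / convergent_cf n (\<lambda>_. 1))))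
      \<longlonglongrightarrow> 1 / (1 + 1 / (real k + 1 / (1 + \<psi>)))"
  proof -
    have "1 / (1 + \<psi>) > 0" "real k + 1 / (1 + \<psi>) > 0" "1 + 1 / (real k + 1 / (1 + \<psi>)) > 0"
      by (simp_all add: add_pos_pos add_nonneg_pos)
    then show ?thesis
      by (intro tendsto_intros convergent_cf_ones) (use psi_pos in linarith)+
  qed
  ultimately have "(\<lambda>n. convergent_cf (n + 3) c) \<longlonglongrightarrow> 1 / (1 + 1 / (real k + 1 / (1 + \<psi>)))"
    by simp
  then have "(\<lambda>n. convergent_cf n c) \<longlonglongrightarrow> 1 / (1 + 1 / (real k + 1 / (1 + \<psi>)))"
    by (rule LIMSEQ_offset)
  moreover have "(\<lambda>n. convergent_cf n c) \<longlonglongrightarrow> \<theta>"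
    using assms(1) unfolding has_continued_fraction_def c_def ones by blast
  ultimately have "\<theta> = 1 / (1 + 1 / (real k + 1 / (1 + \<psi>)))"
    using LIMSEQ_unique by blast
  then have "\<theta> = 1 / (1 + 1 / (real k + \<psi>))" by (simp only: psi_inverse)
  moreover have "real k + \<psi> > 0" using psi_pos by (simp add: add_nonneg_pos)
  ultimately show ?thesis by (simp add: field_simps)
qed

text \<open>One step of the Euclidean algorithm replaces \<open>(X, Y)\<close> by
  \<open>(Y - X, X)\<close> and the weights by \<open>(B, A + B)\<close>. It keeps
  \<open>A * X + B * Y\<close>, lowers the Fibonacci index and divides the error by \<psi>. In the
  base case \<open>Y = 0\<close> or \<open>X\<close> and \<open>Y\<close> have opposite
  signs.\<close>

lemma psi_best_approximation:
  fixes A B :: real and X Y :: int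
  assumes "A > 0" "B > 0" "0 < A * X + B * Y" "A * X + B * Y < A * fib n + B * fib (Suc n)"
  shows "\<psi> ^ n \<le> \<bar>X - \<psi> * Y\<bar>"
  using assms
proof (induction n arbitrary: A B X Y)
  case 0
  show ?case
  proof (cases "Y = 0")
    case True
    then show ?thesis using 0 by (cases "X = 0") auto
  next
    case False
    have "\<not> (X \<ge> 0 \<and> Y \<ge> 1)"
    proof
      assume *: "X \<ge> 0 \<and> Y \<ge> 1"
      then have "A * X \<ge> 0" "B * Y \<ge> B * 1" using 0 by (auto intro!: mult_left_mono simp del: mult_1_right)
      then show False using 0(4) by simp
    qed
    moreover have "\<not> (X \<le> 0 \<and> Y \<le> 0)"
    proof
      assume *: "X \<le> 0 \<and> Y \<le> 0"
      then have "A * X \<le> 0" "B * Y \<le> 0" using 0 by (auto intro!: mult_nonneg_nonpos)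
      then show False using 0(3) by simp
    qed
    ultimately consider "X \<le> -1" "Y \<ge> 1" | "X \<ge> 1" "Y \<le> -1" using False by linarith
    then show ?thesis
    proof cases
      case 1
      then have "real_of_int X \<le> -1" "\<psi> * Y \<ge> 0" by simp_all
      then show ?thesis by simp
    next
      case 2
      then have "real_of_int X \<ge> 1" "\<psi> * Y \<le> 0" by (simp_all add: mult_nonneg_nonpos)
      then show ?thesis by simp
    qed
  qed
next
  case (Suc n)
  have "\<psi> ^ n \<le> \<bar>(Y - X) - \<psi> * X\<bar>"
    using Suc.IH[of B "A + B" "Y - X" X] Suc.prems by (simp add: algebra_simps)
  then have "\<psi> * \<psi> ^ n \<le> \<psi> * \<bar>(Y - X) - \<psi> * X\<bar>"
    by (intro mult_left_mono) simp_all
  also have "\<dots> = \<bar>\<psi> * ((Y - X) - \<psi> * X)\<bar>" by (simp add: abs_mult)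
  also have "\<psi> * ((Y - X) - \<psi> * X) = \<psi> * Y - (\<psi> + \<psi> ^ 2) * X"
    by (simp add: algebra_simps power2_eq_square)
  also have "\<dots> = - (X - \<psi> * Y)" by (simp add: psi_square)
  finally show ?case by (simp del: minus_diff_eq)
qed

text \<open>From the highest value over the window, the steps \<open>A\<close> and \<open>B\<close>
  reach a value lower by at least \<open>D - (a + b)\<close>. As all values lie within
  \<open>D\<close> of each other, adding \<open>e\<close> to the highest one leaves room for at most
  \<open>a + b\<close>.\<close>

lemma rotation_gap:
  fixes g :: "nat \<Rightarrow> real"
  assumes bnd: "\<And>m n. \<bar>g m - g n\<bar> \<le> D"
    and A: "\<And>n. g (n + A) = g n + a \<or> g (n + A) = g n + a - D"
    and B: "\<And>n. g (n + B) = g n - b \<or> g (n + B) = g n - b + D"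
    and pos: "a > 0" "b > 0" and len: "A \<le> l + 1" "B \<le> l + 1"
    and shift: "\<And>t. t \<le> l \<Longrightarrow> g (i + t + p) = g (i + t) + e"
  shows "e \<le> a + b"
proof -
  have "Max ((\<lambda>t. g (i + t)) ` {..l}) \<in> (\<lambda>t. g (i + t)) ` {..l}"
    by (intro Max_in) auto
  then obtain T where "Max ((\<lambda>t. g (i + t)) ` {..l}) = g (i + T)" "T \<in> {..l}"
    by (rule imageE)
  then have T: "T \<le> l" "g (i + T) = Max ((\<lambda>t. g (i + t)) ` {..l})" by simp_all
  then have max: "g (i + t) \<le> g (i + T)" if "t \<le> l" for t
    using that by simp
  \<comment> \<open>A step inside the window cannot exceed the maximum, so a rising one wraps
    around. If the step \<open>A\<close> leaves the window without wrapping, going back by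
    \<open>B\<close> returns into it and wraps there.\<close>
  have "\<exists>s. g s \<le> g (i + T) + a + b - D"
  proof (cases "T \<ge> B")
    case True
    have "g (i + T) = g (i + (T - B)) - b \<or> g (i + T) = g (i + (T - B)) - b + D"
      using B[of "i + (T - B)"] \<open>T \<ge> B\<close> by (simp add: add.assoc)
    moreover have "g (i + (T - B)) \<le> g (i + T)"
      using T(1) by (intro max) simp
    ultimately have "g (i + (T - B)) = g (i + T) + b - D"
      using pos by linarith
    then show ?thesis using pos by (intro exI[of _ "i + (T - B)"]) simp
  next
    case TB: False
    show ?thesis
    proof (cases "g (i + T + A) = g (i + T) + a - D")
      case True
      then show ?thesis using pos by (intro exI[of _ "i + T + A"]) simp
    next
      case False
      then have up: "g (i + T + A) = g (i + T) + a" using A[of "i + T"] by blast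
      then have "\<not> T + A \<le> l" using max[of "T + A"] pos by (auto simp: add.assoc)
      then have s: "i + (T + A - B) + B = i + T + A" "T + A - B \<le> l"
        using TB len T by auto
      then have "g (i + (T + A - B)) = g (i + T) + a + b - D"
        using B[of "i + (T + A - B)"] up max[OF s(2)] pos unfolding s(1) by linarith
      then show ?thesis by (metis order.refl)
    qed
  qed
  then obtain s where "g s \<le> g (i + T) + a + b - D" ..
  with bnd[of "i + T + p" s] shift[OF T(1)] show ?thesis by linarith
qed

section \<open>Long repetitions in words of the given slope\<close>

text \<open>Here \<open>\<alpha> = [k, 1, 1, \<dots>]\<close> and \<open>\<alpha> / D\<close> is the frequency of the letter \<open>a\<close>; scaling by \<open>D\<close>
  clears this denominator.\<close>

locale slope_word =
  fixes u :: "letter word" and \<delta> k :: nat and \<alpha> D :: real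
  assumes delta: "\<delta> \<ge> 7" and k: "k = \<delta> div 2"
    and alpha: "\<alpha> = k + \<psi>" and D: "D = 1 + 2 * \<alpha>"
    and discrepancy: "\<And>i n. \<bar>D * occ u Letter_a i n - n * \<alpha>\<bar> \<le> D"
begin

section \<open>The discrepancy as a rotation\<close>

lemma k_bounds: "3 \<le> k" "2 * k \<le> \<delta>" "\<delta> \<le> 2 * k + 1"
  using delta k by auto

lemma alpha_bounds: "k + 3 / 5 < \<alpha>" "\<alpha> < k + 13 / 21"
  using psi_bounds by (simp_all add: alpha)

lemma D_pos: "D > 0"
  using alpha_bounds by (simp add: D)

text \<open>The scaled discrepancy of the prefix of length \<open>n\<close>; modulo \<open>D\<close>
  it is an orbit of the rotation by \<open>- \<alpha>\<close>.\<close>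

definition g :: "nat \<Rightarrow> real" where
  "g n = D * occ u Letter_a 0 n - n * \<alpha>"

lemma g_add: "g (n + q) = g n + (D * occ u Letter_a n q - q * \<alpha>)"
  using occ_add[of u Letter_a 0 n q] by (simp add: g_def algebra_simps)

lemma g_diff_le: "\<bar>g m - g n\<bar> \<le> D"
proof (induction m n rule: linorder_wlog)
  case (le m n)
  then show ?case using g_add[of m "n - m"] discrepancy[of m "n - m"] by simp
qed (simp add: abs_minus_commute)

text \<open>The increment is congruent to \<open>e\<close> modulo \<open>D\<close> and at most
  \<open>D\<close> in absolute value, which leaves \<open>e\<close> and
  \<open>e - D\<close>.\<close>

lemma step_up:
  fixes r :: int
  assumes "q * \<alpha> = D * r - e" "0 < e" "e < D"
  shows "g (n + q) = g n + e \<or> g (n + q) = g n + e - D"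
proof -
  let ?F = "int (occ u Letter_a n q)"
  have eq: "g (n + q) - g n = D * real_of_int (?F - r) + e"
    using g_add[of n q] assms(1) by (simp add: algebra_simps)
  then have bnd: "\<bar>D * real_of_int (?F - r) + e\<bar> \<le> D" using g_diff_le[of "n + q" n] by simp
  have "?F - r < 1"
  proof (rule ccontr)
    assume "\<not> ?thesis"
    then have "D * 1 \<le> D * real_of_int (?F - r)" using D_pos by (intro mult_left_mono) linarith+
    with bnd assms show False by linarith
  qed
  moreover have "?F - r > -2"
  proof (rule ccontr)
    assume "\<not> ?thesis"
    then have "D * real_of_int (?F - r) \<le> D * (-2)" using D_pos by (intro mult_left_mono) linarith+
    with bnd assms show False by linarith
  qed
  ultimately have "?F - r = 0 \<or> ?F - r = -1" by linarith
  then show ?thesis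
  proof
    assume "?F - r = 0"
    with eq show ?thesis by simp
  next
    assume "?F - r = -1"
    with eq show ?thesis by simp
  qed
qed

lemma step_down:
  fixes r :: int
  assumes "q * \<alpha> = D * r + e" "0 < e" "e < D"
  shows "g (n + q) = g n - e \<or> g (n + q) = g n - e + D"
  using step_up[of q "r + 1" "D - e" n] assms by (auto simp: algebra_simps)

text \<open>Sliding the window by one position drops a letter and gains an equal one.\<close>

lemma occ_shift_invariant:
  assumes "\<And>t. t < l \<Longrightarrow> u (i + t) = u (i + p + t)" "t \<le> l"
  shows "occ u c (i + t) p = occ u c i p"
  using assms(2)
proof (induction t)
  case (Suc t)
  have "of_bool (u (i + t) = c) + occ u c (Suc (i + t)) p = occ u c (i + t) p + of_bool (u (i + t + p) = c)"
    using occ_Suc[of u c "i + t" p] occ_Suc_left[of u c "i + t" p] by simp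
  moreover have "u (i + t + p) = u (i + t)" using assms(1)[of t] Suc.prems by (simp add: add_ac)
  ultimately show ?case using Suc by simp
qed simp

text \<open>The shift by \<open>p\<close> adds the same amount to all \<open>l + 1\<close> values of
  \<open>g\<close> over the repeated word. \<open>rotation_gap\<close> bounds it above via
  \<open>g\<close> and below via the negative of \<open>g\<close>, where \<open>A\<close> and
  \<open>B\<close> swap roles.\<close>

lemma repeat_discrepancy_le:
  fixes A B l :: nat and r s :: int
  assumes up: "A * \<alpha> = D * r - a" "0 < a" "a < D" and down: "B * \<alpha> = D * s + b" "0 < b" "b < D"
    and len: "A \<le> l + 1" "B \<le> l + 1" and rep: "\<And>t. t < l \<Longrightarrow> u (i + t) = u (i + p + t)"
  shows "\<bar>D * occ u Letter_a i p - p * \<alpha>\<bar> \<le> a + b"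
proof -
  have shift: "g (i + t + p) = g (i + t) + (D * occ u Letter_a i p - p * \<alpha>)" if "t \<le> l" for t
    using g_add[of "i + t" p] occ_shift_invariant[OF rep that] by simp
  have "D * occ u Letter_a i p - p * \<alpha> \<le> a + b"
    by (rule rotation_gap[of g D A a B b l i p])
      (use g_diff_le step_up[OF up] step_down[OF down] len shift up down in auto)
  moreover have "- (D * occ u Letter_a i p - p * \<alpha>) \<le> b + a"
  proof (rule rotation_gap[of "\<lambda>n. - g n" D B b A a l i p])
    show "- g (n + B) = - g n + b \<or> - g (n + B) = - g n + b - D" for n
      using step_down[OF down, of n] by auto
    show "- g (n + A) = - g n - a \<or> - g (n + A) = - g n - a + D" for n
      using step_up[OF up, of n] by auto
    show "\<bar>- g m - - g n\<bar> \<le> D" for m n using g_diff_le[of n m] by simp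
  qed (use len shift up down in auto)
  ultimately show ?thesis by linarith
qed

text \<open>\<open>Q n\<close> is the denominator of the convergent of index \<open>n + 2\<close> of
  \<open>\<alpha> / D = [0, 2, k, 1, 1, \<dots>]\<close>, where index \<open>0\<close> belongs to \<open>[0]\<close>.\<close>

definition Q :: "nat \<Rightarrow> nat" where
  "Q n = 2 * fib n + (2 * k + 1) * fib (Suc n)"

lemma Q_Suc_Suc: "Q (Suc (Suc n)) = Q (Suc n) + Q n"
  by (simp add: Q_def algebra_simps)

lemma Q_values: "Q 0 = 2 * k + 1" "Q (Suc 0) = 2 * k + 3" "Q 2 = 4 * k + 4"
  by (simp_all add: Q_def eval_nat_numeral)

lemma less_Q: "n < Q n"
proof (induction n rule: fib.induct)
  case (3 n)
  then show ?case using Q_Suc_Suc[of n] by linarith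
qed (simp_all add: Q_def)

lemma Q_mono: "Q n \<le> Q (Suc n)"
  by (cases n) (simp_all add: Q_values Q_Suc_Suc)

text \<open>As \<open>D = 1 + 2 * \<alpha>\<close>, the error reduces to
  \<open>fib n - fib (Suc n) * \<psi>\<close>, which obeys the Fibonacci recursion and starts like
  the powers of \<open>- \<psi>\<close>.\<close>

lemma convergent_error:
  "Q n * \<alpha> = D * (fib n + k * fib (Suc n)) - (- 1) ^ Suc n * \<psi> ^ Suc n"
proof -
  have fib_psi: "fib n - fib (Suc n) * \<psi> = (- 1) ^ Suc n * \<psi> ^ Suc n"
  proof (induction n rule: fib.induct)
    case (3 n)
    have "fib (Suc (Suc n)) - fib (Suc (Suc (Suc n))) * \<psi> =
        (fib n - fib (Suc n) * \<psi>) + (fib (Suc n) - fib (Suc (Suc n)) * \<psi>)"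
      by (simp add: algebra_simps)
    also have "\<dots> = (- 1) ^ Suc n * (\<psi> ^ Suc n - \<psi> ^ Suc (Suc n))"
      unfolding 3 by (simp add: algebra_simps)
    also have "\<dots> = (- 1) ^ Suc (Suc (Suc n)) * \<psi> ^ Suc (Suc (Suc n))"
      unfolding psi_power_Suc_Suc[of "Suc n", symmetric] by simp
    finally show ?case .
  qed (simp_all add: psi_square flip: power2_eq_square)
  have "D * (fib n + k * fib (Suc n)) - Q n * \<alpha> = fib n - fib (Suc n) * \<psi>"
    by (simp add: Q_def D alpha algebra_simps)
  then show ?thesis using fib_psi by linarith
qed

text \<open>Of two consecutive convergents one steps up and the other down, depending on parity;
  their errors add up to \<open>\<psi> ^ n\<close>.\<close>

lemma repeat_discrepancy_le_convergent:
  assumes len: "Q (Suc n) \<le> l + 1" and rep: "\<And>t. t < l \<Longrightarrow> u (i + t) = u (i + p + t)"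
  shows "\<bar>D * occ u Letter_a i p - p * \<alpha>\<bar> \<le> \<psi> ^ n"
proof -
  have small: "0 < \<psi> ^ m" "\<psi> ^ m < D" for m
  proof -
    show "0 < \<psi> ^ m" by simp
    have "\<psi> ^ m \<le> 1" by (intro power_le_one) (simp_all add: less_imp_le)
    then show "\<psi> ^ m < D" using alpha_bounds by (simp add: D)
  qed
  have len': "Q n \<le> l + 1" using len Q_mono[of n] by linarith
  have sum: "\<psi> ^ n = \<psi> ^ Suc n + \<psi> ^ Suc (Suc n)" using psi_power_Suc_Suc[of n] by simp
  show ?thesis
  proof (cases "even n")
    case True
    then have "Q (Suc n) * \<alpha> = D * real_of_int (fib (Suc n) + k * fib (Suc (Suc n))) - \<psi> ^ Suc (Suc n)"
      "Q n * \<alpha> = D * real_of_int (fib n + k * fib (Suc n)) + \<psi> ^ Suc n"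
      using convergent_error[of n] convergent_error[of "Suc n"] by simp_all
    from repeat_discrepancy_le[OF this(1) small this(2) small len len' rep] sum show ?thesis
      by (simp del: power_Suc fib.simps)
  next
    case False
    then have "Q n * \<alpha> = D * real_of_int (fib n + k * fib (Suc n)) - \<psi> ^ Suc n"
      "Q (Suc n) * \<alpha> = D * real_of_int (fib (Suc n) + k * fib (Suc (Suc n))) + \<psi> ^ Suc (Suc n)"
      using convergent_error[of n] convergent_error[of "Suc n"] by simp_all
    from repeat_discrepancy_le[OF this(1) small this(2) small len' len rep] sum show ?thesis
      by (simp del: power_Suc fib.simps)
  qed
qed

text \<open>The steps \<open>2\<close> and \<open>2 c + 1\<close> belong to an intermediate convergent.\<close>

lemma repeat_discrepancy_le_intermediate:
  assumes "c \<le> k" "2 \<le> l + 1" "2 * c + 1 \<le> l + 1"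
    and rep: "\<And>t. t < l \<Longrightarrow> u (i + t) = u (i + p + t)"
  shows "\<bar>D * occ u Letter_a i p - p * \<alpha>\<bar> \<le> 1 + (\<alpha> - c)"
proof (rule repeat_discrepancy_le[OF _ _ _ _ _ _ assms(2,3) rep])
  show "real 2 * \<alpha> = D * real_of_int 1 - 1" by (simp add: D)
  show "real (2 * c + 1) * \<alpha> = D * real_of_int (int c) + (\<alpha> - c)"
    by (simp add: D algebra_simps)
qed (use assms(1) alpha_bounds in \<open>simp_all add: D\<close>)

text \<open>\<open>X\<close> and \<open>Y\<close> are the coordinates of \<open>(N, r)\<close> in
  the unimodular basis \<open>(2, 1)\<close>, \<open>(2 * k + 1, k)\<close>, whose errors are
  \<open>1\<close> and \<open>- \<psi>\<close>.\<close>

lemma approximation_ge: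
  assumes "N \<ge> 1" "N < Q n"
  shows "\<psi> ^ n \<le> \<bar>D * real r - real N * \<alpha>\<bar>"
proof -
  define X where "X = int r * (2 * int k + 1) - int N * int k"
  define Y where "Y = int N - 2 * int r"
  have N: "real N = 2 * real_of_int X + real (2 * k + 1) * real_of_int Y"
    by (simp add: X_def Y_def algebra_simps)
  have "real N < real (Q n)" using assms(2) by simp
  then have "2 * real_of_int X + real (2 * k + 1) * real_of_int Y <
      2 * real (fib n) + real (2 * k + 1) * real (fib (Suc n))"
    unfolding N[symmetric] by (simp only: Q_def of_nat_add of_nat_mult of_nat_numeral)
  then have "\<psi> ^ n \<le> \<bar>X - \<psi> * Y\<bar>"
    by (intro psi_best_approximation[of 2 "real (2 * k + 1)"])
      (use assms(1) N in linarith)+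
  also have "X - \<psi> * Y = D * real r - real N * \<alpha>"
    by (simp add: X_def Y_def D alpha algebra_simps)
  finally show ?thesis .
qed

text \<open>For the least \<open>n\<close> with \<open>N < Q n\<close>, the rotation by
  \<open>p\<close> has error at least \<open>\<delta> * \<psi> ^ n\<close>. For
  \<open>n > 0\<close>, \<open>Q (n - 1) \<le> N < 2 * l\<close> makes the repeated word long enough
  for steps with a smaller gap.\<close>

lemma no_short_repeat:
  assumes N: "N \<ge> 1" "N + 1 \<le> 2 * l" and p: "p = \<delta> * N" and occ: "occ u Letter_a i p = \<delta> * r"
    and rep: "\<And>t. t < l \<Longrightarrow> u (i + t) = u (i + p + t)"
  shows False
proof -
  let ?d = "\<bar>D * real r - real N * \<alpha>\<bar>"
  have eq: "\<bar>D * occ u Letter_a i p - p * \<alpha>\<bar> = \<delta> * ?d"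
  proof -
    have "D * occ u Letter_a i p - p * \<alpha> = \<delta> * (D * real r - real N * \<alpha>)"
      unfolding occ by (simp add: p algebra_simps)
    then show ?thesis by (simp add: abs_mult)
  qed
  define n where "n = (LEAST n. N < Q n)"
  have less: "N < Q n" unfolding n_def by (rule LeastI[of _ N]) (rule less_Q)
  have ge: "Q m \<le> N" if "m < n" for m
    using not_less_Least[of m "\<lambda>n. N < Q n"] that by (simp add: n_def)
  have dist: "\<psi> ^ n \<le> ?d" using approximation_ge[OF N(1) less] .
  have lower: "x * \<psi> ^ n \<le> \<delta> * ?d" if "0 \<le> x" "x \<le> \<delta>" for x
    using dist that by (intro mult_mono) auto
  have delta': "7 \<le> real \<delta>" "2 * real k \<le> real \<delta>" "3 \<le> real k"
    using delta k_bounds by linarith+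
  have "n = 0 \<and> N = 1 \<or> n = 0 \<and> N \<ge> 2 \<or> n = 1 \<or> n = 2 \<or> n = 3 \<or> n = (n - 4) + 4"
    using N(1) by linarith
  then consider "n = 0" "N = 1" | "n = 0" "N \<ge> 2" | "n = 1" | "n = 2" | "n = 3" | m where "n = m + 4"
    by blast
  then show False
  proof cases
    case 1
    \<comment> \<open>The repeated word may be a single letter here; the trivial bound
      \<open>D = 1 + 2 * \<alpha>\<close> is already below \<open>7 * \<alpha>\<close>.\<close>
    have "\<alpha> \<le> ?d"
    proof (cases "r = 0")
      case True
      then show ?thesis using 1 by simp
    next
      case False
      then have "D * 1 \<le> D * real r" using D_pos by (intro mult_left_mono) auto
      moreover have "?d = \<bar>D * real r - \<alpha>\<bar>" using 1 by simp
      ultimately show ?thesis using D alpha_bounds by linarith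
    qed
    then have "7 * \<alpha> \<le> \<delta> * ?d" using alpha_bounds delta' by (intro mult_mono) auto
    with discrepancy[of i p] eq show False using alpha_bounds delta' by (simp add: D)
  next
    case 2
    have "\<bar>D * occ u Letter_a i p - p * \<alpha>\<bar> \<le> 1 + \<alpha>"
      by (rule repeat_discrepancy_le[of 2 1 1 1 0 \<alpha> l i p])
        (use 2 N rep alpha_bounds in \<open>simp_all add: D\<close>)
    moreover have "real \<delta> \<le> \<delta> * ?d" using lower[of \<delta>] 2(1) by simp
    ultimately show False using eq alpha_bounds delta' by linarith
  next
    case 3
    \<comment> \<open>The largest \<open>c\<close> that \<open>l \<ge> k + 1\<close> guarantees; the
      gap shrinks as \<open>c\<close> grows.\<close>
    define c where "c = (k + 1) div 2"
    have c: "c \<le> k" "real c \<ge> k / 2" using k_bounds by (auto simp: c_def)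
    have "2 * k + 1 \<le> N" using ge[of 0] 3 by (simp add: Q_values)
    with N have "2 \<le> l + 1" "2 * c + 1 \<le> l + 1" using k_bounds by (auto simp: c_def)
    from repeat_discrepancy_le_intermediate[OF c(1) this rep] eq
    have "\<delta> * ?d \<le> 1 + (\<alpha> - c)" by simp
    moreover have "2 * k * \<psi> \<le> \<delta> * ?d" using lower[of "2 * k"] 3 delta' by simp
    moreover have "2 * k * (3 / 5) \<le> 2 * k * \<psi>" using psi_bounds by (intro mult_left_mono) auto
    ultimately show False using c(2) alpha_bounds delta' by linarith
  next
    case 4
    define c where "c = (k + 2) div 2"
    have c: "c \<le> k" "real c \<ge> (k + 1) / 2" using k_bounds by (auto simp: c_def)
    have "2 * k + 3 \<le> N" using ge[of 1] 4 by (simp add: Q_values)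
    with N have "2 \<le> l + 1" "2 * c + 1 \<le> l + 1" using k_bounds by (auto simp: c_def)
    from repeat_discrepancy_le_intermediate[OF c(1) this rep] eq
    have up: "\<delta> * ?d \<le> 1 + (\<alpha> - c)" by simp
    have low: "x * (1 - \<psi>) \<le> \<delta> * ?d" if "0 \<le> x" "x \<le> \<delta>" for x
      using lower[of x] that 4 by (simp add: psi_square)
    \<comment> \<open>The general estimates work from \<open>k = 5\<close> on. For
      \<open>k = 3\<close> the bound \<delta> \<ge> 7 replaces \<delta> \<ge> 2k, and for
      \<open>k = 4\<close> the exact value \<open>c = 3\<close> is used.\<close>
    consider "k = 3" | "k = 4" | "k \<ge> 5" using k_bounds by linarith
    then show False
    proof cases
      case 1
      then have "c = 2" by (simp add: c_def)
      with 1 up low[of 7] alpha delta' psi_bounds show False by simp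
    next
      case 2
      then have "c = 3" by (simp add: c_def)
      with 2 up low[of 8] alpha delta' psi_bounds show False by simp
    next
      case 3
      have "2 * real k * (8 / 21) \<le> 2 * real k * (1 - \<psi>)"
        using psi_bounds by (intro mult_left_mono) auto
      also have "\<dots> \<le> \<delta> * ?d" using low[of "2 * k"] k_bounds by simp
      also note up
      finally have "2 * real k * (8 / 21) \<le> 1 + (\<alpha> - c)" .
      moreover have "real k \<ge> 5" "real c \<ge> (real k + 1) / 2" using 3 c(2) by simp_all
      ultimately show False using alpha_bounds by (simp add: field_simps)
    qed
  next
    case 5
    have "4 * k + 4 \<le> N" using ge[of 2] 5 by (simp add: Q_values)
    \<comment> \<open>The gap is now 1, while \<open>7 * \<psi> ^ 3 = 14 * \<psi> - 7\<close>
      exceeds 1 because \<psi> > 4/7.\<close>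
    then have "Q (Suc 0) \<le> l + 1" using N Q_values by simp
    from repeat_discrepancy_le_convergent[OF this rep] eq lower[of 7] 5 delta'
    have "7 * \<psi> ^ 3 \<le> 1" by simp
    moreover have "\<psi> ^ 3 = \<psi> - \<psi> ^ 2"
      using psi_power_Suc_Suc[of 1] by (simp add: eval_nat_numeral)
    then have "\<psi> ^ 3 = 2 * \<psi> - 1" by (simp add: psi_square)
    ultimately show False using psi_bounds by linarith
  next
    case (6 m)
    have "Q (m + 3) \<le> N" using ge[of "m + 3"] 6 by simp
    \<comment> \<open>Two steps of the recursion at least double \<open>Q\<close>, so half of
      \<open>N\<close> is still at least \<open>Q (Suc m)\<close>. The gap \<open>\<psi> ^ m\<close>
      is then less than 7 times \<open>\<psi> ^ n\<close>.\<close>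
    moreover have "2 * Q (Suc m) \<le> Q (m + 3)"
      using Q_Suc_Suc[of "Suc m"] Q_mono[of "Suc m"] by (simp add: eval_nat_numeral)
    ultimately have "Q (Suc m) \<le> l + 1" using N by linarith
    from repeat_discrepancy_le_convergent[OF this rep] eq have "\<delta> * ?d \<le> \<psi> ^ m" by simp
    moreover have "7 * \<psi> ^ (m + 4) \<le> \<delta> * ?d" using lower[of 7] 6 delta' by simp
    ultimately have "7 * \<psi> ^ (m + 4) \<le> \<psi> ^ m" by (rule order_trans[rotated])
    then have "\<psi> ^ m * (7 * \<psi> ^ 4) \<le> \<psi> ^ m * 1"
      by (simp only: power_add mult.left_commute[of "\<psi> ^ m" 7] mult_1_right)
    then have "7 * \<psi> ^ 4 \<le> 1" by (rule mult_left_le_imp_le) simp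
    moreover have "\<psi> ^ 4 = 2 - 3 * \<psi>"
    proof -
      have "\<psi> ^ 4 = (1 - \<psi>) ^ 2" unfolding psi_square[symmetric] by simp
      then show ?thesis by (simp add: power2_diff psi_square)
    qed
    ultimately show False using psi_bounds by linarith
  qed
qed

end

section \<open>Coloured words\<close>

text \<open>The letters \<open>a\<close> in a window of \<open>u\<close> read off consecutive
  letters of \<open>y\<close>, beginning at the number of \<open>a\<close> before the
  window.\<close>

lemma occ_colour_Inl: "occ (colour u y y') (Inl v) i n = occ y v (occ u Letter_a 0 i) (occ u Letter_a i n)"
proof (induction n)
  case (Suc n)
  have "colour u y y' (i + n) = Inl v \<longleftrightarrow>
      u (i + n) = Letter_a \<and> y (occ u Letter_a 0 i + occ u Letter_a i n) = v"
    using occ_add[of u Letter_a 0 i n]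
    by (simp add: colour_def count_prefix_eq_occ split: letter.split)
  then show ?case using Suc by (cases "u (i + n)") (simp_all add: occ_Suc)
qed simp

lemma occ_colour_Inr: "occ (colour u y y') (Inr v) i n = occ y' v (occ u Letter_b 0 i) (occ u Letter_b i n)"
proof (induction n)
  case (Suc n)
  have "colour u y y' (i + n) = Inr v \<longleftrightarrow>
      u (i + n) = Letter_b \<and> y' (occ u Letter_b 0 i + occ u Letter_b i n) = v"
    using occ_add[of u Letter_b 0 i n]
    by (simp add: colour_def count_prefix_eq_occ split: letter.split)
  then show ?case using Suc by (cases "u (i + n)") (simp_all add: occ_Suc)
qed simp

lemma count_list_distinct_le: "distinct xs \<Longrightarrow> count_list xs v \<le> 1"
  by (induction xs) auto

text \<open>If \<open>q\<close> full periods fit into \<open>F'\<close>, then \<open>F\<close> fits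
  into \<open>q + 1\<close>, and each period contains \<open>v\<close> exactly
  \<open>e \<le> 1\<close> times. The slack between \<open>F\<close> and \<open>F'\<close> absorbs
  the imbalance of \<open>u\<close>.\<close>

lemma occ_iter_distinct_le:
  assumes "distinct xs" "xs \<noteq> []" "F \<le> F' + 1"
  shows "occ (xs\<^sup>\<omega>) v s F \<le> occ (xs\<^sup>\<omega>) v s' F' + 1"
proof -
  let ?w = "xs\<^sup>\<omega>" and ?d = "length xs"
  define e where "e = occ ?w v 0 ?d"
  have period: "?w (n + ?d) = ?w n" for n using assms(2) by simp
  have const: "occ ?w v s ?d = e" for s
  proof (induction s)
    case (Suc s)
    have "of_bool (?w s = v) + occ ?w v (Suc s) ?d = occ ?w v s ?d + of_bool (?w (s + ?d) = v)"
      using occ_Suc[of ?w v s ?d] occ_Suc_left[of ?w v s ?d] by simp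
    then show ?case unfolding period using Suc by simp
  qed (simp add: e_def)
  have "prefix ?d ?w = xs"
    by (rule nth_equalityI) (use assms(2) in simp_all)
  then have "e \<le> 1"
    using count_list_distinct_le[OF assms(1)] by (simp add: e_def occ_def)
  have blocks: "occ ?w v s (q * ?d) = q * e" for s q
  proof (induction q)
    case (Suc q)
    then show ?case using occ_add[of ?w v s "q * ?d" ?d] const by (simp add: add.commute)
  qed simp
  define q where "q = F' div ?d"
  have d: "?d > 0" using assms(2) by simp
  have "q * ?d \<le> F'" by (simp add: q_def)
  then have "q * e \<le> occ ?w v s' F'" using occ_mono blocks by metis
  moreover have "F \<le> Suc q * ?d"
    using dividend_less_div_times[OF d, of F'] assms(3) by (simp add: q_def add.commute)
  then have "occ ?w v s F \<le> Suc q * e" using occ_mono blocks by metis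
  ultimately show ?thesis using \<open>e \<le> 1\<close> by simp
qed

lemma balanced_colour:
  assumes bal: "balanced u" and "distinct xs" "xs \<noteq> []" "distinct xs'" "xs' \<noteq> []"
  shows "balanced (colour u (xs\<^sup>\<omega>) (xs'\<^sup>\<omega>))"
  unfolding balanced_iff_occ
proof (intro allI)
  fix c i j n
  have "occ u l i n \<le> occ u l j n + 1" for l
    using bal by (simp add: balanced_iff_occ)
  then show "occ (colour u (xs\<^sup>\<omega>) (xs'\<^sup>\<omega>)) c i n \<le> occ (colour u (xs\<^sup>\<omega>) (xs'\<^sup>\<omega>)) c j n + 1"
    using assms by (cases c) (auto simp only: occ_colour_Inl occ_colour_Inr intro!: occ_iter_distinct_le)
qed

section \<open>The letters that occur in a coloured word\<close>

lemma occ_attains: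
  assumes "m < occ w c 0 n"
  shows "\<exists>n'. w n' = c \<and> occ w c 0 n' = m"
  using assms
proof (induction n)
  case (Suc n)
  show ?case
  proof (cases "m < occ w c 0 n")
    case False
    with Suc.prems have "w n = c" "occ w c 0 n = m"
      by (cases "w n = c"; simp add: occ_Suc)+
    then show ?thesis by blast
  qed (rule Suc.IH)
qed simp

lemma set_eq_range_iter: "xs \<noteq> [] \<Longrightarrow> range (xs\<^sup>\<omega>) = set xs"
proof
  assume xs: "xs \<noteq> []"
  then show "range (xs\<^sup>\<omega>) \<subseteq> set xs" by auto
  show "set xs \<subseteq> range (xs\<^sup>\<omega>)"
  proof
    fix v assume "v \<in> set xs"
    then obtain i where "i < length xs" "xs ! i = v" by (auto simp: in_set_conv_nth)
    then have "(xs\<^sup>\<omega>) i = v" using xs by simp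
    then show "v \<in> range (xs\<^sup>\<omega>)" by blast
  qed
qed

lemma range_colour:
  assumes unb: "\<And>c m. \<exists>n. m < occ u c 0 n"
  shows "range (colour u y y') = Inl ` range y \<union> Inr ` range y'"
proof
  show "range (colour u y y') \<subseteq> Inl ` range y \<union> Inr ` range y'"
    by (auto simp: colour_def split: letter.split)
  have "Inl (y m) \<in> range (colour u y y')" for m
  proof -
    obtain n where "u n = Letter_a" "occ u Letter_a 0 n = m" using occ_attains unb by metis
    then have "colour u y y' n = Inl (y m)" by (simp add: colour_def count_prefix_eq_occ)
    then show ?thesis by (metis rangeI)
  qed
  moreover have "Inr (y' m) \<in> range (colour u y y')" for m
  proof -
    obtain n where "u n = Letter_b" "occ u Letter_b 0 n = m" using occ_attains unb by metis
    then have "colour u y y' n = Inr (y' m)" by (simp add: colour_def count_prefix_eq_occ)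
    then show ?thesis by (metis rangeI)
  qed
  ultimately show "Inl ` range y \<union> Inr ` range y' \<subseteq> range (colour u y y')" by blast
qed

lemma iter_distinct_eq_iff:
  assumes "distinct zs" "zs \<noteq> []"
  shows "(zs\<^sup>\<omega>) m = (zs\<^sup>\<omega>) (m + n) \<longleftrightarrow> length zs dvd n"
proof -
  have "(zs\<^sup>\<omega>) m = (zs\<^sup>\<omega>) (m + n) \<longleftrightarrow> m mod length zs = (m + n) mod length zs"
    using assms by (simp add: nth_eq_iff_index_eq)
  also have "\<dots> \<longleftrightarrow> length zs dvd (m + n) - m"
    using mod_eq_dvd_iff_nat[of m "m + n" "length zs"] by auto
  finally show ?thesis by simp
qed

text \<open>Reduces repetitions in the coloured word to counts in \<open>u\<close>: between two
  equal letters the colour index grows by the number of occurrences passed, and colours repeat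
  modulo \<open>d\<close>.\<close>

lemma colour_iter_eq_iff:
  assumes "distinct xs" "length xs = d" "distinct xs'" "length xs' = d" "d > 0"
  shows "colour u (xs\<^sup>\<omega>) (xs'\<^sup>\<omega>) i = colour u (xs\<^sup>\<omega>) (xs'\<^sup>\<omega>) (i + p) \<longleftrightarrow>
    u i = u (i + p) \<and> d dvd occ u (u i) i p"
proof -
  have "xs \<noteq> []" "xs' \<noteq> []" using assms by auto
  show ?thesis
  proof (cases "u i = u (i + p)")
    case True
    then show ?thesis
      using occ_add[of u _ 0 i p] iter_distinct_eq_iff[of xs] iter_distinct_eq_iff[of xs'] assms \<open>xs \<noteq> []\<close> \<open>xs' \<noteq> []\<close>
      by (cases "u i") (auto simp: colour_def count_prefix_eq_occ simp del: iter_nth)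
  next
    case False
    then show ?thesis
      by (cases "u i"; cases "u (i + p)") (simp_all add: colour_def)
  qed
qed

section \<open>Distances between equal colours\<close>

context slope_word
begin

lemma occ_a_le: "D * occ u Letter_a i n \<le> n * \<alpha> + D"
  and occ_a_ge: "n * \<alpha> - D \<le> D * occ u Letter_a i n"
  using discrepancy[of i n] by linarith+

lemma two_alpha: "2 * \<alpha> = D - 1"
  by (simp add: D)

lemma D_bounds: "2 * k + 11 / 5 < D" "D < 2 * k + 47 / 21"
  using alpha_bounds by (simp_all add: D)

lemma occ_b_eq: "real (occ u Letter_b i n) = real n - real (occ u Letter_a i n)"
  using occ_ab[of u i n] by linarith

lemma occ_b_le: "D * occ u Letter_b i n \<le> n * (D + 1) / 2 + D"
  and occ_b_ge: "n * (D + 1) / 2 - D \<le> D * occ u Letter_b i n"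
proof -
  have "n * \<alpha> = n * (D - 1) / 2" using two_alpha by simp
  then show "D * occ u Letter_b i n \<le> n * (D + 1) / 2 + D" "n * (D + 1) / 2 - D \<le> D * occ u Letter_b i n"
    unfolding occ_b_eq using occ_a_ge[of n i] occ_a_le[of i n] by (simp_all add: field_simps)
qed

lemma occ_a_le': "D * occ u Letter_a i n \<le> n * (D - 1) / 2 + D"
  and occ_a_ge': "n * (D - 1) / 2 - D \<le> D * occ u Letter_a i n"
proof -
  have "n * \<alpha> = n * (D - 1) / 2" using two_alpha by simp
  then show "D * occ u Letter_a i n \<le> n * (D - 1) / 2 + D" "n * (D - 1) / 2 - D \<le> D * occ u Letter_a i n"
    using occ_a_ge[of n i] occ_a_le[of i n] by linarith+
qed

lemma less_of_mult_D: "D * real a < D * real b \<Longrightarrow> a < b"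
  using D_pos by (simp add: mult_less_cancel_left)

text \<open>The more frequent letter \<open>b\<close> has frequency
  \<open>(D + 1) / (2 * D)\<close>, so the count is at most
  \<open>\<delta> + (\<delta> - 1) / D\<close>, and
  \<open>\<delta> - 1 \<le> 2 * k < D\<close>.\<close>

lemma occ_short_le: "occ u c i (2 * \<delta> - 2) \<le> \<delta>"
proof -
  have n: "real (2 * \<delta> - 2) = 2 * real \<delta> - 2" using delta by simp
  have d: "real \<delta> - 1 < D" using D_bounds k_bounds by simp
  have "D * occ u c i (2 * \<delta> - 2) \<le> real (2 * \<delta> - 2) * (D + 1) / 2 + D"
  proof (cases c)
    case Letter_a
    have "real (2 * \<delta> - 2) * (D - 1) \<le> real (2 * \<delta> - 2) * (D + 1)" by (intro mult_left_mono) auto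
    then show ?thesis using occ_a_le'[of i "2 * \<delta> - 2"] Letter_a by simp
  qed (use occ_b_le[of i "2 * \<delta> - 2"] in simp)
  also have "\<dots> = D * \<delta> + (real \<delta> - 1)" unfolding n by (simp add: field_simps)
  also have "\<dots> < D * Suc \<delta>" using d by (simp add: algebra_simps)
  finally have "occ u c i (2 * \<delta> - 2) < Suc \<delta>" by (rule less_of_mult_D)
  then show ?thesis by simp
qed

lemma occ_unbounded: "\<exists>n. m < occ u c 0 n"
proof -
  define n where "n = nat \<lceil>2 * D * (m + 2)\<rceil>"
  have n: "real n \<ge> 2 * D * (m + 2)" unfolding n_def by linarith
  have "1 \<le> D - 1" using D_bounds by simp
  then have "real n * 1 \<le> real n * (D - 1)" by (intro mult_left_mono) auto
  moreover have "real n * (D - 1) \<le> real n * (D + 1)" by (intro mult_left_mono) auto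
  ultimately have "real n / 2 - D \<le> D * occ u c 0 n"
    using occ_a_ge'[of n 0] occ_b_ge[of n 0] by (cases c) (auto simp: field_simps)
  moreover have "real n / 2 - D \<ge> D * (m + 1)" using n by (simp add: algebra_simps)
  moreover have "D * m < D * (m + 1)" using D_pos by simp
  ultimately have "D * m < D * occ u c 0 n" by linarith
  then show ?thesis using less_of_mult_D by blast
qed

lemma no_aa: "\<not> (u i = Letter_a \<and> u (Suc i) = Letter_a)"
proof
  assume "u i = Letter_a \<and> u (Suc i) = Letter_a"
  then have "occ u Letter_a i 2 = 2" by (simp add: eval_nat_numeral occ_Suc)
  with occ_a_le'[of i 2] show False by simp
qed

lemma no_bbb: "\<not> (u i = Letter_b \<and> u (Suc i) = Letter_b \<and> u (Suc (Suc i)) = Letter_b)"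
proof
  assume "u i = Letter_b \<and> u (Suc i) = Letter_b \<and> u (Suc (Suc i)) = Letter_b"
  then have "occ u Letter_a i 3 = 0" by (simp add: eval_nat_numeral occ_Suc)
  with occ_a_ge[of 3 i] alpha_bounds k_bounds show False by (simp add: D)
qed

text \<open>Without \<open>bb\<close> every window of length 2 contains an \<open>a\<close>, against
  the frequency \<open>(D - 1) / (2 * D) < 1 / 2\<close>.\<close>

lemma ex_bb: "\<exists>i. u i = Letter_b \<and> u (Suc i) = Letter_b"
proof (rule ccontr)
  assume *: "\<not> ?thesis"
  have "occ u Letter_a i 2 \<ge> 1" for i
    using * by (cases "u i"; cases "u (Suc i)") (auto simp: eval_nat_numeral occ_Suc)
  then have ge: "n \<le> occ u Letter_a 0 (2 * n)" for n
  proof (induction n)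
    case (Suc n)
    then show ?case using occ_add[of u Letter_a 0 "2 * n" 2] by (metis add.left_neutral add_le_mono mult_Suc_right add.commute Suc_eq_plus1)
  qed simp
  define n where "n = nat \<lceil>D + 1\<rceil>"
  have "real n > D" unfolding n_def by linarith
  moreover have "D * n \<le> D * occ u Letter_a 0 (2 * n)" using ge[of n] D_pos by (intro mult_left_mono) auto
  with occ_a_le'[of 0 "2 * n"] have "D * n \<le> n * (D - 1) + D" by simp
  ultimately show False by (simp add: algebra_simps)
qed

text \<open>A window beginning with \<open>bb\<close> is poor in \<open>a\<close>: it has at most
  \<open>\<delta> - 2\<close> of them in length \<open>2 * \<delta> - 1\<close>, while the general
  lower bound gives as many already in length \<open>2 * \<delta> - 2\<close>. So the last letter is
  \<open>b\<close>.\<close>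

lemma ex_close_b:
  "\<exists>i. u i = Letter_b \<and> u (i + (2 * \<delta> - 2)) = Letter_b \<and> occ u Letter_b i (2 * \<delta> - 2) = \<delta>"
proof -
  obtain i where i: "u i = Letter_b" "u (Suc i) = Letter_b" using ex_bb by blast
  let ?F = "occ u Letter_a"
  have len: "2 * \<delta> - 1 = 2 + (2 * \<delta> - 3)" "2 * \<delta> - 1 = Suc (2 * \<delta> - 2)" using delta by simp_all
  have "?F i (2 * \<delta> - 1) = ?F (i + 2) (2 * \<delta> - 3)"
    unfolding len(1) occ_add using i by (simp add: eval_nat_numeral occ_Suc)
  then have "D * ?F i (2 * \<delta> - 1) \<le> real (2 * \<delta> - 3) * (D - 1) / 2 + D"
    using occ_a_le'[of "i + 2" "2 * \<delta> - 3"] by simp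
  also have "\<dots> < D * real (\<delta> - 1)"
  proof -
    have "real (2 * \<delta> - 3) = 2 * real \<delta> - 3" "real (\<delta> - 1) = real \<delta> - 1" using delta by simp_all
    moreover have "D < 2 * real \<delta> - 3" using D_bounds k_bounds delta by simp
    ultimately show ?thesis by (simp add: field_simps)
  qed
  finally have upper: "?F i (2 * \<delta> - 1) < \<delta> - 1" by (rule less_of_mult_D)
  have "D * real (\<delta> - 3) < real (2 * \<delta> - 2) * (D - 1) / 2 - D"
  proof -
    have "real (2 * \<delta> - 2) = 2 * real \<delta> - 2" "real (\<delta> - 3) = real \<delta> - 3" using delta by simp_all
    moreover have "real \<delta> - 1 < D" using D_bounds k_bounds by simp
    ultimately show ?thesis by (simp add: field_simps)
  qed
  also have "\<dots> \<le> D * ?F i (2 * \<delta> - 2)" by (rule occ_a_ge')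
  finally have "\<delta> - 3 < ?F i (2 * \<delta> - 2)" by (rule less_of_mult_D)
  moreover from upper
  have upper': "?F i (2 * \<delta> - 2) + of_bool (u (i + (2 * \<delta> - 2)) = Letter_a) < \<delta> - 1"
    unfolding len(2) occ_Suc .
  ultimately have F: "?F i (2 * \<delta> - 2) = \<delta> - 2" by linarith
  have not_a: "u (i + (2 * \<delta> - 2)) \<noteq> Letter_a"
  proof
    assume "u (i + (2 * \<delta> - 2)) = Letter_a"
    with upper' have "?F i (2 * \<delta> - 2) + 1 < \<delta> - 1" by (simp only: of_bool_eq simp_thms)
    with F show False by linarith
  qed
  from F have "occ u Letter_b i (2 * \<delta> - 2) = \<delta>"
    using occ_ab[of u i "2 * \<delta> - 2"] delta by simp
  then show ?thesis using i not_a letter.exhaust by blast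
qed

text \<open>Counting both ends, \<open>p + 1\<close> positions contain at least
  \<open>\<delta> + 1\<close> equal letters, which \<open>occ_short_le\<close> forbids up to length
  \<open>2 * \<delta> - 2\<close>.\<close>

lemma same_letter_distance:
  assumes "p > 0" "u i = u (i + p)" "\<delta> dvd occ u (u i) i p"
  shows "2 * \<delta> - 2 \<le> p"
proof (rule ccontr)
  assume "\<not> ?thesis"
  then have p: "Suc p \<le> 2 * \<delta> - 2" by simp
  have "occ u (u i) i p \<ge> 1" using assms(1) by (cases p) (auto simp: occ_Suc_left)
  then have "occ u (u i) i p \<ge> \<delta>" using assms(3) by (auto intro: dvd_imp_le)
  then have "occ u (u i) i (Suc p) > \<delta>" using assms(2) by (simp add: occ_Suc)
  then show False using occ_mono[OF p, of u "u i" i] occ_short_le[of "u i" i] by linarith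
qed

text \<open>Below the claimed distance the count of \<open>b\<close> is exactly \<delta>. The
  \<open>p + 2\<close> positions including both \<open>bb\<close> contain
  \<open>\<delta> + 2\<close> letters \<open>b\<close>, too many for
  \<open>p = 2 * \<delta> - 2\<close>; the \<open>p - 2\<close> positions between them contain
  \<open>\<delta> - 2\<close>, too few for larger \<open>p\<close>.\<close>

lemma bb_distance:
  assumes "p > 0" and b: "u i = Letter_b" "u (Suc i) = Letter_b" "u (i + p) = Letter_b" "u (Suc (i + p)) = Letter_b"
    and dvd: "\<delta> dvd occ u Letter_b i p"
  shows "2 * (2 * \<delta> - 2) \<le> p"
proof (rule ccontr)
  assume "\<not> ?thesis"
  then have p: "Suc p \<le> (2 * \<delta> - 2) + (2 * \<delta> - 2)" by simp
  have ge: "2 * \<delta> - 2 \<le> p" using same_letter_distance[of p i] assms by simp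
  have "occ u Letter_b i (Suc p) \<le> 2 * \<delta>"
    using occ_mono[OF p, of u Letter_b i] occ_add[of u Letter_b i "2 * \<delta> - 2" "2 * \<delta> - 2"]
      occ_short_le[of Letter_b i] occ_short_le[of Letter_b "i + (2 * \<delta> - 2)"] by linarith
  then have "occ u Letter_b i p < \<delta> * 2" using b by (simp add: occ_Suc)
  moreover have "occ u Letter_b i p > 0" using assms(1) b by (cases p) (auto simp: occ_Suc_left)
  moreover obtain m where m: "occ u Letter_b i p = \<delta> * m" using dvd by blast
  ultimately have "m = 1" using delta by (simp add: mult_less_cancel1)
  then have occ: "occ u Letter_b i p = \<delta>" using m by simp
  have "occ u Letter_b i (p + 2) = \<delta> + 2"
    unfolding add_2_eq_Suc' using occ b by (simp add: occ_Suc)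
  then have 1: "D * (real \<delta> + 2) \<le> (real p + 2) * (D + 1) / 2 + D"
    using occ_b_le[of i "p + 2"] by (simp add: add.commute)
  have split: "2 + (p - 2) = p" using ge delta by linarith
  have "occ u Letter_b i 2 = 2" using b by (simp add: eval_nat_numeral occ_Suc)
  then have "occ u Letter_b (i + 2) (p - 2) = \<delta> - 2"
    using occ_add[of u Letter_b i 2 "p - 2"] unfolding split occ by linarith
  then have 2: "(real p - 2) * (D + 1) / 2 - D \<le> D * (real \<delta> - 2)"
    using occ_b_ge[of "p - 2" "i + 2"] ge delta by simp
  show False
  proof (cases "p = 2 * \<delta> - 2")
    case True
    then have "real p = 2 * real \<delta> - 2" using delta by simp
    with 1 have "D \<le> \<delta>" by (simp add: field_simps)
    then show False using D_bounds k_bounds by simp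
  next
    case False
    then have "real p - 2 \<ge> 2 * real \<delta> - 3" using ge by linarith
    then have "(2 * real \<delta> - 3) * (D + 1) \<le> (real p - 2) * (D + 1)"
      using D_pos by (intro mult_right_mono) auto
    with 2 have "2 * \<delta> \<le> D + 3" by (simp add: field_simps)
    then show False using D_bounds k_bounds delta by simp
  qed
qed

text \<open>If the repeated word contains both letters, both counts are multiples of \<delta> and
  \<open>no_short_repeat\<close> applies. Otherwise it is \<open>a\<close>, \<open>b\<close> or
  \<open>bb\<close>, as \<open>aa\<close> and \<open>bbb\<close> do not occur.\<close>

lemma repeat_distance:
  assumes "p > 0" "l > 0"
    and rep: "\<And>t. t < l \<Longrightarrow> u (i + t) = u (i + p + t) \<and> \<delta> dvd occ u (u (i + t)) (i + t) p"
  shows "(2 * \<delta> - 2) * l \<le> p"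
proof (rule ccontr)
  assume short: "\<not> ?thesis"
  have rep_u: "u (i + t) = u (i + p + t)" if "t < l" for t using rep[OF that] by blast
  have dvd: "\<delta> dvd occ u (u (i + t)) i p" if "t < l" for t
    using rep[OF that] occ_shift_invariant[of l i p t "u (i + t)"] rep_u that by (metis less_imp_le)
  show False
  proof (cases "\<exists>s<l. \<exists>t<l. u (i + s) = Letter_a \<and> u (i + t) = Letter_b")
    case True
    then have "\<delta> dvd occ u Letter_a i p" "\<delta> dvd occ u Letter_b i p" using dvd by metis+
    then obtain r s where rs: "occ u Letter_a i p = \<delta> * r" "occ u Letter_b i p = \<delta> * s" by blast
    then have p: "p = \<delta> * (r + s)" using occ_ab[of u i p] by (simp add: algebra_simps)
    \<comment> \<open>Enlarging \<open>2 * \<delta> - 2\<close> to \<open>2 * \<delta>\<close> lets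
      \<delta> cancel and gives the length condition of \<open>no_short_repeat\<close> for
      \<open>N = r + s\<close>.\<close>
    have "\<delta> * (r + s) < (2 * \<delta> - 2) * l" using short p by simp
    also have "\<dots> \<le> (2 * \<delta>) * l" by (intro mult_le_mono1) simp
    also have "\<dots> = \<delta> * (2 * l)" by simp
    finally have "r + s < 2 * l" using delta by simp
    moreover have "r + s \<ge> 1" using p assms(1) by (cases "r + s") auto
    ultimately show False using no_short_repeat[of "r + s" l p i r] p rs(1) rep_u by simp
  next
    case False
    have same: "u (i + t) = u i" if "t < l" for t
    proof (rule ccontr)
      assume "u (i + t) \<noteq> u i"
      then have "u (i + t) = Letter_a \<and> u (i + 0) = Letter_b \<or>
          u (i + 0) = Letter_a \<and> u (i + t) = Letter_b"
        by (cases "u (i + t)"; cases "u i") simp_all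
      then show False using False assms(2) that by blast
    qed
    have dvd0: "\<delta> dvd occ u (u i) i p" using dvd[of 0] assms(2) by simp
    have "l \<noteq> 1"
      using same_letter_distance[of p i] assms(1) rep_u[of 0] dvd0 short by auto
    then have l: "l \<ge> 2" using assms(2) by simp
    then have i1: "u (Suc i) = u i" using same[of 1] by simp
    then have b: "u i = Letter_b" using no_aa[of i] by (cases "u i") auto
    then have "\<not> 2 < l" using same[of 2] i1 no_bbb[of i] by (auto simp: numeral_2_eq_2)
    then have "l = 2" using l by linarith
    moreover from this have "2 * (2 * \<delta> - 2) \<le> p"
      using bb_distance[of p i] assms(1) b i1 rep_u[of 0] rep_u[of 1] dvd0 by simp
    ultimately show False using short by simp
  qed
qed

end

section \<open>The critical exponent of the coloured word\<close>

lemma Least_is_period: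
  assumes "z \<noteq> []"
  shows "is_period (LEAST p. is_period p z) z"
  by (rule LeastI[of _ "length z"]) (use assms in \<open>simp add: is_period_def\<close>)

theorem theorem4:
  fixes \<delta> :: nat and \<theta> :: real and u :: "letter word"
    and y y' :: "nat word" and x :: "(nat + nat) word"
  assumes "\<delta> \<ge> 7"
    and "standard u"
    and "has_slope u \<theta>"
    and "has_continued_fraction \<theta> ([0, 1, \<delta> div 2] \<frown> [1]\<^sup>\<omega>)"
    and "y = [1..<\<delta> + 1]\<^sup>\<omega>"
    and "y' = [1..<\<delta> + 1]\<^sup>\<omega>"
    and "x = colour u y y'"
  shows "balanced x \<and> card (range x) = 2 * \<delta> \<and>
    critical_exponent x = ereal ((2 * real \<delta> - 1) / (2 * real \<delta> - 2))"
proof -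
  define k where "k = \<delta> div 2"
  define \<alpha> where "\<alpha> = k + \<psi>"
  define D where "D = 1 + 2 * \<alpha>"
  have "k > 0" using assms(1) by (simp add: k_def)
  have \<alpha>: "\<alpha> > 0" by (simp add: \<alpha>_def add_nonneg_pos)
  have "sturmian u" using assms(2) by (simp add: standard_def)
  note bal_a = sturmian_imp_occ_balanced[OF this]
  have "occ u Letter_b i n \<le> occ u Letter_b j n + 1" for i j n
    using bal_a[of j n i] occ_ab[of u i n] occ_ab[of u j n] by linarith
  with bal_a have "occ u c i n \<le> occ u c j n + 1" for c i j n
    by (cases c) simp_all
  then have "balanced u" by (simp add: balanced_iff_occ)
  obtain \<rho>\<^sub>a \<rho>\<^sub>b where freq: "has_frequency u Letter_a \<rho>\<^sub>a" "has_frequency u Letter_b \<rho>\<^sub>b"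
    and \<rho>: "\<rho>\<^sub>a < \<rho>\<^sub>b" "\<theta> = \<rho>\<^sub>a / \<rho>\<^sub>b"
    using assms(3) by (auto simp: has_slope_def)
  have "(\<lambda>n. real (occ u Letter_a 0 n) / n + real (occ u Letter_b 0 n) / n) \<longlonglongrightarrow> \<rho>\<^sub>a + \<rho>\<^sub>b"
    using tendsto_add[OF freq[unfolded has_frequency_def count_prefix_eq_occ]] .
  moreover have "\<forall>\<^sub>F n in sequentially. real (occ u Letter_a 0 n) / n + real (occ u Letter_b 0 n) / n = 1"
  proof (rule eventually_sequentiallyI[of 1])
    fix n :: nat assume "1 \<le> n"
    then show "real (occ u Letter_a 0 n) / n + real (occ u Letter_b 0 n) / n = 1"
      unfolding add_divide_distrib[symmetric] of_nat_add[symmetric] occ_ab by simp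
  qed
  ultimately have "\<rho>\<^sub>a + \<rho>\<^sub>b = 1"
    using tendsto_eventually LIMSEQ_unique by metis
  \<comment> \<open>Together with \<open>\<rho>\<^sub>a + \<rho>\<^sub>b = 1\<close> this makes the
    frequency of \<open>a\<close> equal to \<open>\<alpha> / D\<close>.\<close>
  have "\<theta> = \<alpha> / (1 + \<alpha>)"
    using slope_value[OF assms(4)] \<open>k > 0\<close> by (simp add: \<alpha>_def k_def)
  then have "\<theta> * (1 + \<alpha>) = \<alpha>" using \<alpha> by simp
  moreover have "\<rho>\<^sub>a = \<theta> * \<rho>\<^sub>b" using \<rho> \<open>\<rho>\<^sub>a + \<rho>\<^sub>b = 1\<close> by simp
  then have "\<rho>\<^sub>a * (1 + \<alpha>) = \<theta> * (1 + \<alpha>) * \<rho>\<^sub>b" by simp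
  ultimately have "\<rho>\<^sub>a * (1 + \<alpha>) = \<alpha> * \<rho>\<^sub>b" by simp
  moreover have "\<rho>\<^sub>b = 1 - \<rho>\<^sub>a" using \<open>\<rho>\<^sub>a + \<rho>\<^sub>b = 1\<close> by simp
  ultimately have "\<rho>\<^sub>a * (1 + \<alpha>) = \<alpha> * (1 - \<rho>\<^sub>a)" by simp
  then have \<rho>\<^sub>a: "\<rho>\<^sub>a * D = \<alpha>" by (simp add: D_def algebra_simps)
  have "D > 0" using \<alpha> by (simp add: D_def)
  interpret slope_word u \<delta> k \<alpha> D
  proof
    fix i n
    have "D * \<bar>real (occ u Letter_a i n) - n * \<rho>\<^sub>a\<bar> \<le> D * 1"
      using occ_frequency_bound[OF bal_a freq(1)] \<open>D > 0\<close> by (intro mult_left_mono) auto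
    moreover have "D * \<bar>real (occ u Letter_a i n) - n * \<rho>\<^sub>a\<bar> = \<bar>D * (real (occ u Letter_a i n) - n * \<rho>\<^sub>a)\<bar>"
      using \<open>D > 0\<close> by (simp add: abs_mult)
    moreover have "D * (real (occ u Letter_a i n) - n * \<rho>\<^sub>a) = D * occ u Letter_a i n - n * \<alpha>"
      using \<rho>\<^sub>a by (simp add: algebra_simps)
    ultimately show "\<bar>D * occ u Letter_a i n - n * \<alpha>\<bar> \<le> D" by simp
  qed (use assms(1) in \<open>simp_all add: k_def \<alpha>_def D_def\<close>)
  let ?w = "[1..<\<delta> + 1]" and ?P = "2 * \<delta> - 2"
  have w: "distinct ?w" "length ?w = \<delta>" "?w \<noteq> []" "\<delta> > 0" using assms(1) by simp_all
  have x: "x = colour u (?w\<^sup>\<omega>) (?w\<^sup>\<omega>)" using assms(5-7) by simp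
  have bal: "balanced x" unfolding x by (intro balanced_colour w \<open>balanced u\<close>)
  have "range x = Inl ` set ?w \<union> Inr ` set ?w"
    unfolding x by (simp only: range_colour[OF occ_unbounded] set_eq_range_iter[OF w(3)])
  then have "card (range x) = card (Inl ` set ?w :: (nat + nat) set) + card (Inr ` set ?w :: (nat + nat) set)"
    by (simp only:) (intro card_Un_disjoint; auto)
  then have card: "card (range x) = 2 * \<delta>"
    by (simp only: card_image inj_Inl inj_Inr distinct_card[OF w(1)] w(2))
  note x_eq = colour_iter_eq_iff[OF w(1,2) w(1,2) w(4), of u, folded x]
  have P: "real ?P = 2 * real \<delta> - 2" "?P > 0" using assms(1) by simp_all
  have "exponent z \<le> (2 * real \<delta> - 1) / (2 * real \<delta> - 2)" if z: "z \<in> factors x" "z \<noteq> []" for z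
  proof -
    define p where "p = (LEAST p. is_period p z)"
    have "is_period p z" unfolding p_def by (rule Least_is_period[OF z(2)])
    then have per: "p > 0" "\<And>j. j + p < length z \<Longrightarrow> z ! j = z ! (j + p)"
      unfolding is_period_def by blast+
    \<comment> \<open>The part of \<open>z\<close> beyond its period \<open>p\<close> is a word
      repeated at distance \<open>p\<close>, so \<open>repeat_distance\<close> bounds its length by
      \<open>p / ?P\<close>.\<close>
    have "real (length z) \<le> real p + real p / ?P"
    proof (cases "length z \<le> p")
      case False
      define l where "l = length z - p"
      have l: "l > 0" "length z = l + p" using False by (simp_all add: l_def)
      have "z \<in> range (\<lambda>i. x [i \<rightarrow> i + length z])"
        unfolding factors_length_eq[symmetric] using z(1) by simp
      then obtain i where i: "z = x [i \<rightarrow> i + length z]" by (rule rangeE)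
      have nth: "z ! j = x (i + j)" if "j < length z" for j
        using that by (subst i) simp
      have "?P * l \<le> p"
      proof (rule repeat_distance[OF per(1) l(1)])
        fix t assume t: "t < l"
        have swap: "i + t + p = i + p + t" by simp
        have "z ! t = z ! (t + p)" using t by (intro per(2)) (simp add: l)
        moreover have "z ! t = x (i + t)" "z ! (t + p) = x (i + t + p)"
          using nth[of t] nth[of "t + p"] t l by (simp_all add: add.assoc)
        ultimately have "x (i + t) = x (i + t + p)" by simp
        then have "u (i + t) = u (i + t + p) \<and> \<delta> dvd occ u (u (i + t)) (i + t) p"
          unfolding x_eq .
        then show "u (i + t) = u (i + p + t) \<and> \<delta> dvd occ u (u (i + t)) (i + t) p"
          unfolding swap .
      qed
      then have "real ?P * real l \<le> real p" by (metis of_nat_mult of_nat_mono)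
      then have "real l \<le> real p / ?P" using P(2) by (simp add: pos_le_divide_eq mult.commute)
      then show ?thesis using l by simp
    next
      case True
      then show ?thesis by (intro add_increasing2) simp_all
    qed
    then have "exponent z \<le> (real p + real p / ?P) / p"
      unfolding exponent_def p_def[symmetric] by (intro divide_right_mono) simp_all
    also have "\<dots> = 1 + 1 / ?P" using per(1) by (simp add: add_divide_distrib)
    also have "\<dots> = (2 * real \<delta> - 1) / (2 * real \<delta> - 2)"
      unfolding P(1) using P by (simp add: field_simps)
    finally show ?thesis .
  qed
  then have upper: "critical_exponent x \<le> ereal ((2 * real \<delta> - 1) / (2 * real \<delta> - 2))"
    unfolding critical_exponent_def by (intro SUP_least) auto
  \<comment> \<open>Two equal colours of \<open>b\<close> at distance \<open>?P\<close> enclose a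
    factor of length \<open>?P + 1\<close> with period \<open>?P\<close>.\<close>
  obtain i where i: "u i = Letter_b" "u (i + ?P) = Letter_b" "occ u Letter_b i ?P = \<delta>"
    using ex_close_b by blast
  then have xi: "x i = x (i + ?P)" unfolding x_eq by simp
  define z where "z = x [i \<rightarrow> i + Suc ?P]"
  have z: "z \<in> factors x" "z \<noteq> []" "length z = Suc ?P"
    unfolding z_def by (rule subsequence_in_factors) simp_all
  have period: "is_period ?P z"
    unfolding is_period_def
  proof (intro conjI allI impI)
    fix j assume "j + ?P < length z"
    then have "j = 0" using z(3) by linarith
    moreover have "z ! 0 = x i" "z ! ?P = x (i + ?P)" by (simp_all add: z_def)
    ultimately show "z ! j = z ! (j + ?P)" using xi by simp
  qed (rule P(2))
  define q where "q = (LEAST p. is_period p z)"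
  have "is_period q z" unfolding q_def by (rule Least_is_period[OF z(2)])
  then have "q > 0" by (simp add: is_period_def)
  \<comment> \<open>A least period below \<open>?P\<close> would only raise the exponent.\<close>
  moreover have "q \<le> ?P" unfolding q_def by (rule Least_le) (rule period)
  ultimately have "exponent z \<ge> real (Suc ?P) / real ?P"
    unfolding exponent_def z(3) q_def[symmetric] by (intro divide_left_mono of_nat_mono) simp_all
  also have "real (Suc ?P) / real ?P = (2 * real \<delta> - 1) / (2 * real \<delta> - 2)"
    using P(1) by simp
  finally have "ereal ((2 * real \<delta> - 1) / (2 * real \<delta> - 2)) \<le> critical_exponent x"
    unfolding critical_exponent_def using z by (intro SUP_upper2[of z]) auto
  with upper bal card show ?thesis by (simp add: antisym)
qed

end
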